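(* The subalgebra $\mathrm Y^{\rm tw}_q(\mathfrak{sp}_{2n})$ of $\mathrm U_q(\widehat{\mathfrak{gl}}_{2n})$ is a left coideal, that is, $\Delta(\mathrm Y^{\rm tw}_q(\mathfrak{sp}_{2n}))\subset \mathrm U_q(\widehat{\mathfrak{gl}}_{2n})\otimes\mathrm Y^{\rm tw}_q(\mathfrak{sp}_{2n})$, and $$\Delta(s_{ij}(u))=\sum_{k,l=1}^{2n} t_{ik}(u)\,\bar t_{jl}(u^{-1})\otimes s_{kl}(u)\qquad(1\le i,j\le 2n).$$
   Context: Fix $q\in\mathbb C$, nonzero and not a root of unity, and put $N=2n$. $E_{ij}$ are matrix units; a matrix $M=(m_{ij})$ over an algebra is identified with $\sum m_{ij}\otimes E_{ij}$, $M^t$ is its transpose, and $M_a$ means that $M$ acts in the $a$-th copy of $\mathrm{End}\,\mathbb C^N$. Put $$R(u,v)=(u-v)\sum_{i\ne j}E_{ii}\otimes E_{jj}+(q^{-1}u-qv)\sum_iE_{ii}\otimes E_{ii}+(q^{-1}-q)u\sum_{i>j}E_{ij}\otimes E_{ji}+(q^{-1}-q)v\sum_{i<j}E_{ij}\otimes E_{ji}.$$ The quantum affine algebra $\mathrm U_q(\widehat{\mathfrak{gl}}_N)$ is generated by $t_{ij}^{(r)},\bar t_{ij}^{\,(r)}$ ($1\le i,j\le N$, $r\ge0$). With $t_{ij}(u)=\sum_{r\ge0}t_{ij}^{(r)}u^{-r}$, $\bar t_{ij}(u)=\sum_{r\ge0}\bar t_{ij}^{\,(r)}u^{r}$, $T(u)=(t_{ij}(u))$,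 $\overline T(u)=(\bar t_{ij}(u))$, the defining relations are: $t_{ij}^{(0)}=\bar t_{ji}^{\,(0)}=0$ for $i<j$; $t_{ii}^{(0)}\bar t_{ii}^{\,(0)}=\bar t_{ii}^{\,(0)}t_{ii}^{(0)}=1$; $R(u,v)T_1(u)T_2(v)=T_2(v)T_1(u)R(u,v)$; $R(u,v)\overline T_1(u)\overline T_2(v)=\overline T_2(v)\overline T_1(u)R(u,v)$; $R(u,v)\overline T_1(u)T_2(v)=T_2(v)\overline T_1(u)R(u,v)$. It is a Hopf algebra with coproduct $\Delta(t_{ij}(u))=\sum_k t_{ik}(u)\otimes t_{kj}(u)$, $\Delta(\bar t_{ij}(u))=\sum_k\bar t_{ik}(u)\otimes\bar t_{kj}(u)$. The prime denotes the involution of $\{1,\dots,2n\}$ with $(2k-1)'=2k$, $(2k)'=2k-1$. Let $G=q\sum_{k=1}^nE_{2k-1,2k}-\sum_{k=1}^nE_{2k,2k-1}$. $\mathrm Y^{\rm tw}_q(\mathfrak{sp}_{2n})$ is the subalgebra generated by the coefficients $s_{ij}^{(r)}$ of the entries $s_{ij}(u)=\sum_{r\ge0}s_{ij}^{(r)}u^{-r}$ of the matrix $S(u)=T(u)\,G\,\overline T(u^{-1})^t$ and by the elements $(s_{ii'}^{(0)})^{-1}$, $i=1,3,\dots,2n-1$ (where $s_{ii'}^{(0)}=q\,t_{ii}^{(0)}\bar t_{i'i'}^{\,(0)}$ is invertible). *)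

theory Defs
  imports
    "HOL-Computational_Algebra.Polynomial"
    "HOL-Algebra.Module"
    "HOL-Algebra.QuotRing"
    "HOL-Algebra.Subrings"
begin

hide_const (open) Polynomial.smult

section \<open>Associative algebras over the complex numbers\<close>

text \<open>
  A unital associative (in general noncommutative) \<open>\<complex>\<close>-algebra is a record of type
  \<open>(complex, 'a) module\<close>.
\<close>

definition alg_hom ::
    "(complex, 'a) module \<Rightarrow> (complex, 'b) module \<Rightarrow> ('a \<Rightarrow> 'b) set" where
  "alg_hom A B =
     {h \<in> ring_hom A B. \<forall>c. \<forall>x\<in>carrier A. h (c \<odot>\<^bsub>A\<^esub> x) = c \<odot>\<^bsub>B\<^esub> h x}"

definition is_subalg :: "'a set \<Rightarrow> (complex, 'a) module \<Rightarrow> bool" where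
  "is_subalg B A \<longleftrightarrow> subring B A \<and> (\<forall>c. \<forall>b\<in>B. c \<odot>\<^bsub>A\<^esub> b \<in> B)"

definition subalg_gen :: "(complex, 'a) module \<Rightarrow> 'a set \<Rightarrow> 'a set" where
  "subalg_gen A X = \<Inter>{B. is_subalg B A \<and> X \<subseteq> B}"

definition monoid_alg :: "('g, 'm) monoid_scheme \<Rightarrow> (complex, 'g \<Rightarrow> complex) module" where
  "monoid_alg M =
    \<lparr>carrier = {f. finite {x. f x \<noteq> 0} \<and> {x. f x \<noteq> 0} \<subseteq> carrier M},
     mult = (\<lambda>f g z. \<Sum>x\<in>{x. f x \<noteq> 0}. \<Sum>y\<in>{y. g y \<noteq> 0}.
               if x \<otimes>\<^bsub>M\<^esub> y = z then f x * g y else 0),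
     one = (\<lambda>x. if x = \<one>\<^bsub>M\<^esub> then 1 else 0),
     zero = (\<lambda>_. 0),
     add = (\<lambda>f g x. f x + g x),
     smult = (\<lambda>c f x. c * f x)\<rparr>"

definition basis_elt :: "'g \<Rightarrow> 'g \<Rightarrow> complex" where
  "basis_elt x = (\<lambda>y. if y = x then 1 else 0)"

definition word_monoid :: "'g set \<Rightarrow> 'g list monoid" where
  "word_monoid X = \<lparr>carrier = lists X, mult = (@), one = []\<rparr>"

definition free_alg :: "'g set \<Rightarrow> (complex, 'g list \<Rightarrow> complex) module" where
  "free_alg X = monoid_alg (word_monoid X)"

text \<open>
  The quotient by a two-sided ideal \<open>I\<close>. The scalar multiple of a coset \<open>X\<close> is written as a union so
  that it is again a full coset for the scalar 0.
\<close>

definition alg_quot :: "(complex, 'a) module \<Rightarrow> 'a set \<Rightarrow> (complex, 'a set) module" where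
  "alg_quot A I =
    \<lparr>carrier = carrier (A Quot I),
     mult = mult (A Quot I),
     one = one (A Quot I),
     zero = zero (A Quot I),
     add = add (A Quot I),
     smult = (\<lambda>c X. \<Union>x\<in>X. I +>\<^bsub>A\<^esub> (c \<odot>\<^bsub>A\<^esub> x))\<rparr>"


section \<open>Tensor products\<close>

text \<open>
  The tensor product of algebras is the free vector space on \<open>carrier A \<times> carrier B\<close> modulo the
  bilinearity relations. The free vector space carries the product
  \<open>(a, b) (a', b') = (a a', b b')\<close>. The set of relations is stable, up to relations, under
  multiplication by basis elements on either side, so the two-sided ideal it generates is its
  linear span.
\<close>

definition bilinear_rels ::
    "(complex, 'a) module \<Rightarrow> (complex, 'b) module \<Rightarrow> ('a \<times> 'b \<Rightarrow> complex) set" where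
  "bilinear_rels A B = (let F = monoid_alg (A \<times>\<times> B) in
     {basis_elt (a \<oplus>\<^bsub>A\<^esub> a', b) \<ominus>\<^bsub>F\<^esub> (basis_elt (a, b) \<oplus>\<^bsub>F\<^esub> basis_elt (a', b)) | a a' b.
        a \<in> carrier A \<and> a' \<in> carrier A \<and> b \<in> carrier B} \<union>
     {basis_elt (a, b \<oplus>\<^bsub>B\<^esub> b') \<ominus>\<^bsub>F\<^esub> (basis_elt (a, b) \<oplus>\<^bsub>F\<^esub> basis_elt (a, b')) | a b b'.
        a \<in> carrier A \<and> b \<in> carrier B \<and> b' \<in> carrier B} \<union>
     {basis_elt (c \<odot>\<^bsub>A\<^esub> a, b) \<ominus>\<^bsub>F\<^esub> c \<odot>\<^bsub>F\<^esub> basis_elt (a, b) | c a b.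
        a \<in> carrier A \<and> b \<in> carrier B} \<union>
     {basis_elt (a, c \<odot>\<^bsub>B\<^esub> b) \<ominus>\<^bsub>F\<^esub> c \<odot>\<^bsub>F\<^esub> basis_elt (a, b) | c a b.
        a \<in> carrier A \<and> b \<in> carrier B})"

definition tensor_ideal ::
    "(complex, 'a) module \<Rightarrow> (complex, 'b) module \<Rightarrow> ('a \<times> 'b \<Rightarrow> complex) set" where
  "tensor_ideal A B = Idl\<^bsub>monoid_alg (A \<times>\<times> B)\<^esub> (bilinear_rels A B)"

definition alg_tensor ::
    "(complex, 'a) module \<Rightarrow> (complex, 'b) module \<Rightarrow> (complex, ('a \<times> 'b \<Rightarrow> complex) set) module"
  where
  "alg_tensor A B = alg_quot (monoid_alg (A \<times>\<times> B)) (tensor_ideal A B)"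

definition pure_tensor ::
    "(complex, 'a) module \<Rightarrow> (complex, 'b) module \<Rightarrow> 'a \<Rightarrow> 'b \<Rightarrow> ('a \<times> 'b \<Rightarrow> complex) set" where
  "pure_tensor A B a b = tensor_ideal A B +>\<^bsub>monoid_alg (A \<times>\<times> B)\<^esub> basis_elt (a, b)"

text \<open>
  For subspaces \<open>X\<close> of \<open>A\<close> and \<open>Z\<close> of \<open>B\<close>, the tensor product of \<open>X\<close> and \<open>Z\<close>
  regarded as a subspace of the tensor product of \<open>A\<close> and \<open>B\<close> (over a field the canonical map is
  injective).
\<close>

definition sub_tensor ::
    "(complex, 'a) module \<Rightarrow> (complex, 'b) module \<Rightarrow> 'a set \<Rightarrow> 'b set
       \<Rightarrow> ('a \<times> 'b \<Rightarrow> complex) set set" where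
  "sub_tensor A B X Z =
     {(\<Oplus>\<^bsub>alg_tensor A B\<^esub>i\<in>{..<m}. pure_tensor A B (x i) (z i)) | (m::nat) x z.
        (\<forall>i<m. x i \<in> X \<and> z i \<in> Z)}"


section \<open>Formal series and matrices\<close>

text \<open>
  One-sided formal series over \<open>A\<close>, given by their coefficients. The formal variable is
  \<open>u\<^sup>-\<^sup>1\<close> for \<open>t\<^sub>i\<^sub>j(u)\<close>, \<open>s\<^sub>i\<^sub>j(u)\<close> and \<open>\<bar>t\<^sub>i\<^sub>j(u\<^sup>-\<^sup>1)\<close>, and \<open>u\<close> for \<open>\<bar>t\<^sub>i\<^sub>j(u)\<close>.
\<close>

definition series_ring :: "(complex, 'a) module \<Rightarrow> (nat \<Rightarrow> 'a) ring" where
  "series_ring A =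
    \<lparr>carrier = {f. \<forall>r. f r \<in> carrier A},
     mult = (\<lambda>f g r. \<Oplus>\<^bsub>A\<^esub>a\<in>{..r}. f a \<otimes>\<^bsub>A\<^esub> g (r - a)),
     one = (\<lambda>r. if r = 0 then \<one>\<^bsub>A\<^esub> else \<zero>\<^bsub>A\<^esub>),
     zero = (\<lambda>_. \<zero>\<^bsub>A\<^esub>),
     add = (\<lambda>f g r. f r \<oplus>\<^bsub>A\<^esub> g r)\<rparr>"

definition const_series :: "(complex, 'a) module \<Rightarrow> complex \<Rightarrow> nat \<Rightarrow> 'a" where
  "const_series A c = (\<lambda>r. if r = 0 then c \<odot>\<^bsub>A\<^esub> \<one>\<^bsub>A\<^esub> else \<zero>\<^bsub>A\<^esub>)"

definition series_tensor ::
    "(complex, 'a) module \<Rightarrow> (complex, 'b) module \<Rightarrow> (nat \<Rightarrow> 'a) \<Rightarrow> (nat \<Rightarrow> 'b)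
       \<Rightarrow> nat \<Rightarrow> ('a \<times> 'b \<Rightarrow> complex) set" where
  "series_tensor A B f g =
     (\<lambda>r. \<Oplus>\<^bsub>alg_tensor A B\<^esub>a\<in>{..r}. pure_tensor A B (f a) (g (r - a)))"

type_synonym 'a mat = "nat \<Rightarrow> nat \<Rightarrow> 'a"

text \<open>Matrices are indexed by \<open>{1..N}\<close>; entries outside this range are irrelevant.\<close>

definition mat_prod :: "('a, 'm) ring_scheme \<Rightarrow> nat \<Rightarrow> 'a mat \<Rightarrow> 'a mat \<Rightarrow> 'a mat" where
  "mat_prod R N M M' = (\<lambda>i j. \<Oplus>\<^bsub>R\<^esub>k\<in>{1..N}. M i k \<otimes>\<^bsub>R\<^esub> M' k j)"

definition mat_transpose :: "'a mat \<Rightarrow> 'a mat" where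
  "mat_transpose M = (\<lambda>i j. M j i)"

definition mat_unit :: "nat \<Rightarrow> nat \<Rightarrow> 'a::zero_neq_one mat" where
  "mat_unit a b = (\<lambda>i j. if i = a \<and> j = b then 1 else 0)"


section \<open>The quantum affine algebra\<close>

text \<open>
  Polynomials in \<open>u, v\<close> are elements of \<open>complex poly poly\<close>, with \<open>u\<close> the outer and \<open>v\<close> the inner
  variable.
\<close>

definition var_u :: "complex poly poly" where "var_u = [:0, 1:]"
definition var_v :: "complex poly poly" where "var_v = [:[:0, 1:]:]"
definition cst :: "complex \<Rightarrow> complex poly poly" where "cst c = [:[:c:]:]"

text \<open>\<open>Rmat N q i j k l\<close> is the coefficient of \<open>E\<^sub>i\<^sub>j \<otimes> E\<^sub>k\<^sub>l\<close> in \<open>R(u,v)\<close>.\<close>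

definition Rmat :: "nat \<Rightarrow> complex \<Rightarrow> nat \<Rightarrow> nat \<Rightarrow> nat \<Rightarrow> nat \<Rightarrow> complex poly poly" where
  "Rmat N q i j k l =
     (var_u - var_v) *
       (\<Sum>a\<in>{1..N}. \<Sum>b\<in>{1..N} - {a}. mat_unit a a i j * mat_unit b b k l)
   + (cst (inverse q) * var_u - cst q * var_v) *
       (\<Sum>a\<in>{1..N}. mat_unit a a i j * mat_unit a a k l)
   + cst (inverse q - q) * var_u *
       (\<Sum>a\<in>{1..N}. \<Sum>b\<in>{b\<in>{1..N}. a > b}. mat_unit a b i j * mat_unit b a k l)
   + cst (inverse q - q) * var_v *
       (\<Sum>a\<in>{1..N}. \<Sum>b\<in>{b\<in>{1..N}. a < b}. mat_unit a b i j * mat_unit b a k l)"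

text \<open>
  Two-sided formal series in \<open>u, v\<close> are functions \<open>F\<close> with \<open>F m p\<close> the coefficient of
  \<open>u\<^sup>m v\<^sup>p\<close>; they are multiplied by polynomials in \<open>u, v\<close> as follows.
\<close>

definition poly_act ::
    "(complex, 'a) module \<Rightarrow> complex poly poly \<Rightarrow> (int \<Rightarrow> int \<Rightarrow> 'a) \<Rightarrow> int \<Rightarrow> int \<Rightarrow> 'a" where
  "poly_act A P F m p =
     (\<Oplus>\<^bsub>A\<^esub>c\<in>{..degree P}. \<Oplus>\<^bsub>A\<^esub>d\<in>{..degree (poly.coeff P c)}.
        poly.coeff (poly.coeff P c) d \<odot>\<^bsub>A\<^esub> F (m - int c) (p - int d))"

text \<open>
  The coefficients of \<open>u\<^sup>m v\<^sup>p\<close> in the \<open>E\<^sub>i\<^sub>j \<otimes> E\<^sub>k\<^sub>l\<close> components of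
  \<open>R(u,v) X\<^sub>1(u) Y\<^sub>2(v)\<close> and of \<open>Y\<^sub>2(v) X\<^sub>1(u) R(u,v)\<close>.
\<close>

definition rtt_left ::
    "(complex, 'a) module \<Rightarrow> nat \<Rightarrow> complex \<Rightarrow> (int \<Rightarrow> 'a) mat \<Rightarrow> (int \<Rightarrow> 'a) mat
       \<Rightarrow> nat \<Rightarrow> nat \<Rightarrow> nat \<Rightarrow> nat \<Rightarrow> int \<Rightarrow> int \<Rightarrow> 'a" where
  "rtt_left A N q X Y i j k l m p =
     (\<Oplus>\<^bsub>A\<^esub>a\<in>{1..N}. \<Oplus>\<^bsub>A\<^esub>b\<in>{1..N}.
        poly_act A (Rmat N q i a k b) (\<lambda>m p. X a j m \<otimes>\<^bsub>A\<^esub> Y b l p) m p)"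

definition rtt_right ::
    "(complex, 'a) module \<Rightarrow> nat \<Rightarrow> complex \<Rightarrow> (int \<Rightarrow> 'a) mat \<Rightarrow> (int \<Rightarrow> 'a) mat
       \<Rightarrow> nat \<Rightarrow> nat \<Rightarrow> nat \<Rightarrow> nat \<Rightarrow> int \<Rightarrow> int \<Rightarrow> 'a" where
  "rtt_right A N q X Y i j k l m p =
     (\<Oplus>\<^bsub>A\<^esub>a\<in>{1..N}. \<Oplus>\<^bsub>A\<^esub>b\<in>{1..N}.
        poly_act A (Rmat N q a j b l) (\<lambda>m p. Y k b p \<otimes>\<^bsub>A\<^esub> X i a m) m p)"

definition rtt_rels ::
    "(complex, 'a) module \<Rightarrow> nat \<Rightarrow> complex \<Rightarrow> (int \<Rightarrow> 'a) mat \<Rightarrow> (int \<Rightarrow> 'a) mat \<Rightarrow> 'a set" where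
  "rtt_rels A N q X Y =
     {rtt_left A N q X Y i j k l m p \<ominus>\<^bsub>A\<^esub> rtt_right A N q X Y i j k l m p | i j k l m p.
        i \<in> {1..N} \<and> j \<in> {1..N} \<and> k \<in> {1..N} \<and> l \<in> {1..N}}"

datatype gen = Gen_t nat nat nat | Gen_tbar nat nat nat

definition gens :: "nat \<Rightarrow> gen set" where
  "gens N = {Gen_t i j r | i j r. i \<in> {1..N} \<and> j \<in> {1..N}} \<union>
            {Gen_tbar i j r | i j r. i \<in> {1..N} \<and> j \<in> {1..N}}"

abbreviation word_t :: "nat \<Rightarrow> nat \<Rightarrow> nat \<Rightarrow> gen list \<Rightarrow> complex" where
  "word_t i j r \<equiv> basis_elt [Gen_t i j r]"

abbreviation word_tbar :: "nat \<Rightarrow> nat \<Rightarrow> nat \<Rightarrow> gen list \<Rightarrow> complex" where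
  "word_tbar i j r \<equiv> basis_elt [Gen_tbar i j r]"

text \<open>\<open>T(u)\<close> has coefficients in nonpositive, \<open>\<bar>T(u)\<close> in nonnegative powers of \<open>u\<close>.\<close>

definition Tmat :: "(int \<Rightarrow> gen list \<Rightarrow> complex) mat" where
  "Tmat i j = (\<lambda>m. if m \<le> 0 then word_t i j (nat (- m)) else (\<lambda>_. 0))"

definition Tbarmat :: "(int \<Rightarrow> gen list \<Rightarrow> complex) mat" where
  "Tbarmat i j = (\<lambda>m. if m \<ge> 0 then word_tbar i j (nat m) else (\<lambda>_. 0))"

definition Uq_rels :: "nat \<Rightarrow> complex \<Rightarrow> (gen list \<Rightarrow> complex) set" where
  "Uq_rels N q = (let F = free_alg (gens N) in
     {word_t i j 0 | i j. i \<in> {1..N} \<and> j \<in> {1..N} \<and> i < j} \<union>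
     {word_tbar j i 0 | i j. i \<in> {1..N} \<and> j \<in> {1..N} \<and> i < j} \<union>
     {word_t i i 0 \<otimes>\<^bsub>F\<^esub> word_tbar i i 0 \<ominus>\<^bsub>F\<^esub> \<one>\<^bsub>F\<^esub> | i. i \<in> {1..N}} \<union>
     {word_tbar i i 0 \<otimes>\<^bsub>F\<^esub> word_t i i 0 \<ominus>\<^bsub>F\<^esub> \<one>\<^bsub>F\<^esub> | i. i \<in> {1..N}} \<union>
     rtt_rels F N q Tmat Tmat \<union>
     rtt_rels F N q Tbarmat Tbarmat \<union>
     rtt_rels F N q Tbarmat Tmat)"

definition Uq_ideal :: "nat \<Rightarrow> complex \<Rightarrow> (gen list \<Rightarrow> complex) set" where
  "Uq_ideal N q = Idl\<^bsub>free_alg (gens N)\<^esub> (Uq_rels N q)"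

definition Uq :: "nat \<Rightarrow> complex \<Rightarrow> (complex, (gen list \<Rightarrow> complex) set) module" where
  "Uq N q = alg_quot (free_alg (gens N)) (Uq_ideal N q)"

text \<open>
  The series \<open>t\<^sub>i\<^sub>j(u)\<close> in \<open>u\<^sup>-\<^sup>1\<close>, and \<open>\<bar>t\<^sub>i\<^sub>j\<close>, which is both the series
  \<open>\<bar>t\<^sub>i\<^sub>j(u)\<close> in \<open>u\<close> and the series \<open>\<bar>t\<^sub>i\<^sub>j(u\<^sup>-\<^sup>1)\<close> in \<open>u\<^sup>-\<^sup>1\<close>.
\<close>

definition t_ser :: "nat \<Rightarrow> complex \<Rightarrow> (nat \<Rightarrow> (gen list \<Rightarrow> complex) set) mat" where
  "t_ser N q i j = (\<lambda>r. Uq_ideal N q +>\<^bsub>free_alg (gens N)\<^esub> word_t i j r)"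

definition tbar_ser :: "nat \<Rightarrow> complex \<Rightarrow> (nat \<Rightarrow> (gen list \<Rightarrow> complex) set) mat" where
  "tbar_ser N q i j = (\<lambda>r. Uq_ideal N q +>\<^bsub>free_alg (gens N)\<^esub> word_tbar i j r)"

text \<open>
  The coproduct; the conditions determine it on the carrier, since the algebra is generated by the
  coefficients of \<open>t\<^sub>i\<^sub>j(u)\<close> and \<open>\<bar>t\<^sub>i\<^sub>j(u)\<close>.
\<close>

definition is_coproduct ::
    "nat \<Rightarrow> complex \<Rightarrow>
     ((gen list \<Rightarrow> complex) set \<Rightarrow>
        ((gen list \<Rightarrow> complex) set \<times> (gen list \<Rightarrow> complex) set \<Rightarrow> complex) set) \<Rightarrow> bool" where
  "is_coproduct N q \<Delta> \<longleftrightarrow> (let U = Uq N q; UU = alg_tensor U U in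
     \<Delta> \<in> alg_hom U UU \<and>
     (\<forall>i\<in>{1..N}. \<forall>j\<in>{1..N}.
        (\<lambda>r. \<Delta> (t_ser N q i j r)) =
          (\<Oplus>\<^bsub>series_ring UU\<^esub>k\<in>{1..N}. series_tensor U U (t_ser N q i k) (t_ser N q k j)) \<and>
        (\<lambda>r. \<Delta> (tbar_ser N q i j r)) =
          (\<Oplus>\<^bsub>series_ring UU\<^esub>k\<in>{1..N}. series_tensor U U (tbar_ser N q i k) (tbar_ser N q k j))))"


section \<open>The symplectic twisted q-Yangian\<close>

definition idx_prime :: "nat \<Rightarrow> nat" where
  "idx_prime i = (if odd i then i + 1 else i - 1)"

definition Gmat :: "nat \<Rightarrow> complex \<Rightarrow> complex mat" where
  "Gmat n q i j = q * (\<Sum>k\<in>{1..n}. mat_unit (2 * k - 1) (2 * k) i j)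
                  - (\<Sum>k\<in>{1..n}. mat_unit (2 * k) (2 * k - 1) i j)"

definition s_ser :: "nat \<Rightarrow> complex \<Rightarrow> (nat \<Rightarrow> (gen list \<Rightarrow> complex) set) mat" where
  "s_ser n q = (let U = Uq (2 * n) q; R = series_ring U in
     mat_prod R (2 * n)
       (mat_prod R (2 * n) (t_ser (2 * n) q) (\<lambda>i j. const_series U (Gmat n q i j)))
       (mat_transpose (tbar_ser (2 * n) q)))"

definition Ytw_sp :: "nat \<Rightarrow> complex \<Rightarrow> (gen list \<Rightarrow> complex) set set" where
  "Ytw_sp n q = subalg_gen (Uq (2 * n) q)
     ({s_ser n q i j r | i j r. i \<in> {1..2 * n} \<and> j \<in> {1..2 * n}} \<union>
      {inv\<^bsub>Uq (2 * n) q\<^esub> (s_ser n q i (idx_prime i) 0) | i. i \<in> {1..2 * n} \<and> odd i})"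

end

theory Submission
  imports Defs "HOL-Algebra.UnivPoly"
begin

text \<open>
  Applied coefficientwise, \<open>\<Delta>\<close> is a homomorphism of series rings, and in the series ring over the
  tensor square \<open>f \<otimes> g\<close> is the product of the commuting images of \<open>f\<close> and \<open>g\<close> under the two
  embeddings. Hence \<open>\<Delta>(T) G \<Delta>(\<bar>T)\<^sup>t\<close> can be regrouped with all factors from the second leg
  collected into \<open>S\<close>, which gives the formula for \<open>\<Delta>(s\<^sub>i\<^sub>j(u))\<close>.

  The elements that \<open>\<Delta>\<close> maps into \<open>U \<otimes> Y\<close> form a subalgebra, so the coideal property need only be
  checked on generators. For an inverse generator, triangularity of \<open>T\<close> and \<open>\<bar>T\<close> at order 0 leaves
  only diagonal terms: with \<open>x = t\<^sub>i\<^sub>i \<bar>t\<^sub>i\<^sub>'\<^sub>i\<^sub>'\<close> and \<open>s = q x\<close> one gets \<open>\<Delta>(s) = x \<otimes> s\<close>, whence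
  \<open>\<Delta>(s\<^sup>-\<^sup>1) = x\<^sup>-\<^sup>1 \<otimes> s\<^sup>-\<^sup>1\<close>.
\<close>

section \<open>Complex algebras\<close>

text \<open>\<open>Uq\<close> and \<open>alg_tensor\<close> are both quotients of monoid algebras,
  one over words and one over the product monoid \<open>A \<times>\<times> B\<close>. Two
  constructions, the monoid algebra and the quotient by an ideal, therefore supply the algebra
  structure in both places. All these algebras are noncommutative, and this shapes the regrouping: a
  factor is only ever moved past a factor from the opposite leg, never past one from its own leg.
  The formula comes out because in each leg the entry of T already stands to the left of the entry
  of the second matrix, and the scalars from G can be sent to the right leg, between the two. The
  inverse generators need an argument of their own because the preimage of a subalgebra under a
  homomorphism need not contain the inverses of its units. What helps is that the second leg of the
  coproduct of \<open>s\<close> is \<open>s\<close> itself, whose inverse is a generator, while the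
  first leg only has to be invertible somewhere in the big algebra.\<close>

locale complex_alg = ring A for A :: "(complex, 'a) module" (structure) +
  assumes smult_closed [simp, intro]: "x \<in> carrier A \<Longrightarrow> c \<odot> x \<in> carrier A"
    and smult_r_distr: "x \<in> carrier A \<Longrightarrow> y \<in> carrier A \<Longrightarrow> c \<odot> (x \<oplus> y) = c \<odot> x \<oplus> c \<odot> y"
    and smult_l_distr: "x \<in> carrier A \<Longrightarrow> (c + d) \<odot> x = c \<odot> x \<oplus> d \<odot> x"
    and smult_assoc: "x \<in> carrier A \<Longrightarrow> (c * d) \<odot> x = c \<odot> (d \<odot> x)"
    and smult_one [simp]: "x \<in> carrier A \<Longrightarrow> 1 \<odot> x = x"
    and smult_mult_left: "x \<in> carrier A \<Longrightarrow> y \<in> carrier A \<Longrightarrow> c \<odot> x \<otimes> y = c \<odot> (x \<otimes> y)"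
    and smult_mult_right: "x \<in> carrier A \<Longrightarrow> y \<in> carrier A \<Longrightarrow> x \<otimes> (c \<odot> y) = c \<odot> (x \<otimes> y)"

lemma (in complex_alg) smult_zero_right [simp]: "c \<odot> \<zero> = \<zero>"
  using smult_r_distr[of \<zero> \<zero> c] add.l_cancel_one'[of "c \<odot> \<zero>" "c \<odot> \<zero>"] by simp

lemma (in complex_alg) smult_zero_left: "x \<in> carrier A \<Longrightarrow> 0 \<odot> x = \<zero>"
  using smult_l_distr[of x 0 0] add.l_cancel_one'[of "0 \<odot> x" "0 \<odot> x"] by simp

lemma (in abelian_monoid) finsum_swap:
  assumes "finite I" "finite J" "\<And>i j. i \<in> I \<Longrightarrow> j \<in> J \<Longrightarrow> f i j \<in> carrier G"
  shows "(\<Oplus>i\<in>I. \<Oplus>j\<in>J. f i j) = (\<Oplus>j\<in>J. \<Oplus>i\<in>I. f i j)"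
  using assms(1,3)
proof (induction I rule: finite_induct)
  case (insert x I)
  have "(\<Oplus>i\<in>insert x I. \<Oplus>j\<in>J. f i j) = (\<Oplus>j\<in>J. f x j) \<oplus> (\<Oplus>i\<in>I. \<Oplus>j\<in>J. f i j)"
    using insert assms(2) by (subst finsum_insert) (auto intro!: finsum_closed)
  also have "\<dots> = (\<Oplus>j\<in>J. f x j) \<oplus> (\<Oplus>j\<in>J. \<Oplus>i\<in>I. f i j)"
    using insert by simp
  also have "\<dots> = (\<Oplus>j\<in>J. f x j \<oplus> (\<Oplus>i\<in>I. f i j))"
    using insert by (subst finsum_addf) (auto intro!: finsum_closed)
  also have "\<dots> = (\<Oplus>j\<in>J. \<Oplus>i\<in>insert x I. f i j)"
    using insert by (intro finsum_cong') (auto intro!: finsum_closed)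
  finally show ?case .
qed simp

section \<open>Monoid algebras\<close>

text \<open>The product is defined by sums over exact supports, and supports behave badly under
  addition, scaling and multiplication. Replacing them by arbitrary finite supersets lets several
  products be compared over the same index sets.\<close>

lemma monoid_alg_mult_eq:
  assumes "finite S" "{x. f x \<noteq> 0} \<subseteq> S" "finite T" "{x. g x \<noteq> 0} \<subseteq> T"
  shows "(f \<otimes>\<^bsub>monoid_alg M\<^esub> g) z = (\<Sum>x\<in>S. \<Sum>y\<in>T. if x \<otimes>\<^bsub>M\<^esub> y = z then f x * g y else 0)"
proof -
  have "(\<Sum>y\<in>{y. g y \<noteq> 0}. if x \<otimes>\<^bsub>M\<^esub> y = z then f x * g y else 0)
      = (\<Sum>y\<in>T. if x \<otimes>\<^bsub>M\<^esub> y = z then f x * g y else 0)" for x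
    using assms by (intro sum.mono_neutral_left) auto
  moreover have "(\<Sum>x\<in>{x. f x \<noteq> 0}. \<Sum>y\<in>T. if x \<otimes>\<^bsub>M\<^esub> y = z then f x * g y else 0)
      = (\<Sum>x\<in>S. \<Sum>y\<in>T. if x \<otimes>\<^bsub>M\<^esub> y = z then f x * g y else 0)"
    using assms by (intro sum.mono_neutral_left) (auto intro!: sum.neutral split: if_splits)
  ultimately show ?thesis
    by (simp add: monoid_alg_def)
qed

context Group.monoid
begin

lemma basis_elt_closed: "x \<in> carrier G \<Longrightarrow> basis_elt x \<in> carrier (monoid_alg G)"
  by (auto simp: monoid_alg_def basis_elt_def intro: finite_subset[of _ "{x}"])

lemma basis_elt_mult: "basis_elt x \<otimes>\<^bsub>monoid_alg G\<^esub> basis_elt y = basis_elt (x \<otimes> y)"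
  by (rule ext, subst monoid_alg_mult_eq[of "{x}" _ "{y}"]) (auto simp: basis_elt_def)

lemma monoid_alg_mult_closed:
  assumes "f \<in> carrier (monoid_alg G)" "g \<in> carrier (monoid_alg G)"
  shows "f \<otimes>\<^bsub>monoid_alg G\<^esub> g \<in> carrier (monoid_alg G)"
proof -
  let ?S = "{x. f x \<noteq> 0}" and ?T = "{x. g x \<noteq> 0}"
  have *: "finite ?S" "finite ?T" "?S \<subseteq> carrier G" "?T \<subseteq> carrier G"
    using assms by (auto simp: monoid_alg_def)
  have "{z. (f \<otimes>\<^bsub>monoid_alg G\<^esub> g) z \<noteq> 0} \<subseteq> (\<lambda>(x, y). x \<otimes> y) ` (?S \<times> ?T)"
  proof
    fix z assume "z \<in> {z. (f \<otimes>\<^bsub>monoid_alg G\<^esub> g) z \<noteq> 0}"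
    then have "(\<Sum>x\<in>?S. \<Sum>y\<in>?T. if x \<otimes> y = z then f x * g y else 0) \<noteq> 0"
      using monoid_alg_mult_eq[of ?S f ?T g G z] * by simp
    then obtain x where x: "x \<in> ?S" "(\<Sum>y\<in>?T. if x \<otimes> y = z then f x * g y else 0) \<noteq> 0"
      by (rule sum.not_neutral_contains_not_neutral)
    from x(2) obtain y where y: "y \<in> ?T" "(if x \<otimes> y = z then f x * g y else 0) \<noteq> 0"
      by (rule sum.not_neutral_contains_not_neutral)
    from x(1) y show "z \<in> (\<lambda>(x, y). x \<otimes> y) ` (?S \<times> ?T)"
      by (auto split: if_splits)
  qed
  moreover have "(\<lambda>(x, y). x \<otimes> y) ` (?S \<times> ?T) \<subseteq> carrier G"
    using *(3,4) by (auto intro!: m_closed)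
  moreover have "finite ((\<lambda>(x, y). x \<otimes> y) ` (?S \<times> ?T))"
    using * by simp
  ultimately have "finite {z. (f \<otimes>\<^bsub>monoid_alg G\<^esub> g) z \<noteq> 0} \<and>
      {z. (f \<otimes>\<^bsub>monoid_alg G\<^esub> g) z \<noteq> 0} \<subseteq> carrier G"
    by (meson finite_subset subset_trans)
  then show ?thesis
    by (simp add: monoid_alg_def)
qed

lemma monoid_alg_mult_assoc:
  assumes "f \<in> carrier (monoid_alg G)" "g \<in> carrier (monoid_alg G)" "h \<in> carrier (monoid_alg G)"
  shows "f \<otimes>\<^bsub>monoid_alg G\<^esub> g \<otimes>\<^bsub>monoid_alg G\<^esub> h = f \<otimes>\<^bsub>monoid_alg G\<^esub> (g \<otimes>\<^bsub>monoid_alg G\<^esub> h)"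
proof
  fix z
  let ?S = "{x. f x \<noteq> 0}" and ?T = "{x. g x \<noteq> 0}" and ?V = "{x. h x \<noteq> 0}"
  let ?fg = "f \<otimes>\<^bsub>monoid_alg G\<^esub> g" and ?gh = "g \<otimes>\<^bsub>monoid_alg G\<^esub> h"
  have fin: "finite ?S" "finite ?T" "finite ?V"
    and sub: "?S \<subseteq> carrier G" "?T \<subseteq> carrier G" "?V \<subseteq> carrier G"
    using assms by (auto simp: monoid_alg_def)
  \<comment> \<open>\<open>W\<close> has to contain the support of \<open>?fg\<close> to be an
    admissible index set, and also every product \<open>x \<otimes> y\<close>: coefficients of
    \<open>?fg\<close> may cancel, and a product missing from \<open>W\<close> would lose its term
    when the sum over \<open>w\<close> collapses. \<open>W'\<close> serves the same purpose for
    \<open>?gh\<close>.\<close>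
  define W where "W = (\<lambda>(x, y). x \<otimes> y) ` (?S \<times> ?T) \<union> {w. ?fg w \<noteq> 0}"
  define W' where "W' = (\<lambda>(x, y). x \<otimes> y) ` (?T \<times> ?V) \<union> {w. ?gh w \<noteq> 0}"
  have W: "finite W" "{w. ?fg w \<noteq> 0} \<subseteq> W" "\<And>x y. x \<in> ?S \<Longrightarrow> y \<in> ?T \<Longrightarrow> x \<otimes> y \<in> W"
    using fin monoid_alg_mult_closed[OF assms(1,2)] by (auto simp: W_def monoid_alg_def)
  have W': "finite W'" "{w. ?gh w \<noteq> 0} \<subseteq> W'" "\<And>x y. x \<in> ?T \<Longrightarrow> y \<in> ?V \<Longrightarrow> x \<otimes> y \<in> W'"
    using fin monoid_alg_mult_closed[OF assms(2,3)] by (auto simp: W'_def monoid_alg_def)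
  have fg: "?fg w = (\<Sum>x\<in>?S. \<Sum>y\<in>?T. if x \<otimes> y = w then f x * g y else 0)" for w
    using fin by (intro monoid_alg_mult_eq) auto
  have gh: "?gh w = (\<Sum>x\<in>?T. \<Sum>y\<in>?V. if x \<otimes> y = w then g x * h y else 0)" for w
    using fin by (intro monoid_alg_mult_eq) auto
  have "(?fg \<otimes>\<^bsub>monoid_alg G\<^esub> h) z = (\<Sum>w\<in>W. \<Sum>v\<in>?V. if w \<otimes> v = z then ?fg w * h v else 0)"
    using fin W by (intro monoid_alg_mult_eq) auto
  also have "\<dots> = (\<Sum>w\<in>W. \<Sum>v\<in>?V. \<Sum>x\<in>?S. \<Sum>y\<in>?T.
      if w = x \<otimes> y then if w \<otimes> v = z then f x * g y * h v else 0 else 0)"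
    by (intro sum.cong refl) (auto simp: fg sum_distrib_right intro!: sum.cong sum.neutral)
  also have "\<dots> = (\<Sum>v\<in>?V. \<Sum>x\<in>?S. \<Sum>y\<in>?T. \<Sum>w\<in>W.
      if w = x \<otimes> y then if w \<otimes> v = z then f x * g y * h v else 0 else 0)"
    by (simp only: sum.swap[where A = W])
  also have "\<dots> = (\<Sum>v\<in>?V. \<Sum>x\<in>?S. \<Sum>y\<in>?T. if x \<otimes> y \<otimes> v = z then f x * g y * h v else 0)"
    using W by (intro sum.cong refl) (simp add: sum.delta)
  also have "\<dots> = (\<Sum>x\<in>?S. \<Sum>y\<in>?T. \<Sum>v\<in>?V. if x \<otimes> y \<otimes> v = z then f x * g y * h v else 0)"
    by (simp only: sum.swap[where A = ?V])
  also have "\<dots> = (\<Sum>x\<in>?S. \<Sum>y\<in>?T. \<Sum>v\<in>?V. if x \<otimes> (y \<otimes> v) = z then f x * (g y * h v) else 0)"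
  proof (intro sum.cong refl)
    fix x y v assume "x \<in> ?S" "y \<in> ?T" "v \<in> ?V"
    then have "x \<in> carrier G" "y \<in> carrier G" "v \<in> carrier G"
      using sub by auto
    then show "(if x \<otimes> y \<otimes> v = z then f x * g y * h v else 0) =
        (if x \<otimes> (y \<otimes> v) = z then f x * (g y * h v) else 0)"
      by (simp add: m_assoc)
  qed
  also have "\<dots> = (\<Sum>x\<in>?S. \<Sum>y\<in>?T. \<Sum>v\<in>?V. \<Sum>w\<in>W'.
      if w = y \<otimes> v then if x \<otimes> w = z then f x * (g y * h v) else 0 else 0)"
    using W' by (intro sum.cong refl) (simp add: sum.delta)
  also have "\<dots> = (\<Sum>x\<in>?S. \<Sum>w\<in>W'. \<Sum>y\<in>?T. \<Sum>v\<in>?V.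
      if w = y \<otimes> v then if x \<otimes> w = z then f x * (g y * h v) else 0 else 0)"
    by (simp only: sum.swap[where B = W'])
  also have "\<dots> = (\<Sum>x\<in>?S. \<Sum>w\<in>W'. if x \<otimes> w = z then f x * ?gh w else 0)"
    by (intro sum.cong refl) (auto simp: gh sum_distrib_left intro!: sum.cong sum.neutral)
  also have "\<dots> = (f \<otimes>\<^bsub>monoid_alg G\<^esub> ?gh) z"
    using fin W' by (intro monoid_alg_mult_eq[symmetric]) auto
  finally show "(?fg \<otimes>\<^bsub>monoid_alg G\<^esub> h) z = (f \<otimes>\<^bsub>monoid_alg G\<^esub> ?gh) z" .
qed

lemma monoid_alg_distr:
  assumes "f \<in> carrier (monoid_alg G)" "g \<in> carrier (monoid_alg G)" "h \<in> carrier (monoid_alg G)"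
  shows "(f \<oplus>\<^bsub>monoid_alg G\<^esub> g) \<otimes>\<^bsub>monoid_alg G\<^esub> h =
      f \<otimes>\<^bsub>monoid_alg G\<^esub> h \<oplus>\<^bsub>monoid_alg G\<^esub> g \<otimes>\<^bsub>monoid_alg G\<^esub> h"
    and "h \<otimes>\<^bsub>monoid_alg G\<^esub> (f \<oplus>\<^bsub>monoid_alg G\<^esub> g) =
      h \<otimes>\<^bsub>monoid_alg G\<^esub> f \<oplus>\<^bsub>monoid_alg G\<^esub> h \<otimes>\<^bsub>monoid_alg G\<^esub> g"
proof -
  \<comment> \<open>A single index set covering all supports turns both sides into double sums over
    the same range, so that distributivity can be checked term by term.\<close>
  define S where "S = {x. f x \<noteq> 0} \<union> {x. g x \<noteq> 0} \<union> {x. h x \<noteq> 0}"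
  have S: "finite S"
    using assms by (auto simp: S_def monoid_alg_def)
  have mult: "(k \<otimes>\<^bsub>monoid_alg G\<^esub> l) z =
      (\<Sum>x\<in>S. \<Sum>y\<in>S. if x \<otimes> y = z then k x * l y else 0)"
    if "{x. k x \<noteq> 0} \<subseteq> S" "{x. l x \<noteq> 0} \<subseteq> S" for k l z
    using S that by (intro monoid_alg_mult_eq) auto
  have sub: "{x. f x \<noteq> 0} \<subseteq> S" "{x. g x \<noteq> 0} \<subseteq> S" "{x. h x \<noteq> 0} \<subseteq> S"
      "{x. f x + g x \<noteq> 0} \<subseteq> S"
    by (auto simp: S_def)
  have add: "k \<oplus>\<^bsub>monoid_alg G\<^esub> l = (\<lambda>z. k z + l z)" for k l
    by (simp add: monoid_alg_def)
  show "(f \<oplus>\<^bsub>monoid_alg G\<^esub> g) \<otimes>\<^bsub>monoid_alg G\<^esub> h =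
      f \<otimes>\<^bsub>monoid_alg G\<^esub> h \<oplus>\<^bsub>monoid_alg G\<^esub> g \<otimes>\<^bsub>monoid_alg G\<^esub> h"
    unfolding add mult[OF sub(4,3)] mult[OF sub(1,3)] mult[OF sub(2,3)] fun_eq_iff
      sum.distrib[symmetric]
    by (auto intro!: sum.cong simp: distrib_right)
  show "h \<otimes>\<^bsub>monoid_alg G\<^esub> (f \<oplus>\<^bsub>monoid_alg G\<^esub> g) =
      h \<otimes>\<^bsub>monoid_alg G\<^esub> f \<oplus>\<^bsub>monoid_alg G\<^esub> h \<otimes>\<^bsub>monoid_alg G\<^esub> g"
    unfolding add mult[OF sub(3,4)] mult[OF sub(3,1)] mult[OF sub(3,2)] fun_eq_iff
      sum.distrib[symmetric]
    by (auto intro!: sum.cong simp: distrib_left)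
qed

lemma monoid_alg_one_mult:
  assumes "f \<in> carrier (monoid_alg G)"
  shows "\<one>\<^bsub>monoid_alg G\<^esub> \<otimes>\<^bsub>monoid_alg G\<^esub> f = f" and "f \<otimes>\<^bsub>monoid_alg G\<^esub> \<one>\<^bsub>monoid_alg G\<^esub> = f"
proof -
  let ?S = "{x. f x \<noteq> 0}"
  have S: "finite ?S" "\<And>x. x \<in> ?S \<Longrightarrow> x \<in> carrier G"
    using assms by (auto simp: monoid_alg_def)
  have one: "\<one>\<^bsub>monoid_alg G\<^esub> = basis_elt \<one>"
    by (auto simp: monoid_alg_def basis_elt_def)
  show "\<one>\<^bsub>monoid_alg G\<^esub> \<otimes>\<^bsub>monoid_alg G\<^esub> f = f"
  proof
    fix z
    have "(\<one>\<^bsub>monoid_alg G\<^esub> \<otimes>\<^bsub>monoid_alg G\<^esub> f) z =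
        (\<Sum>x\<in>{\<one>}. \<Sum>y\<in>?S. if x \<otimes> y = z then basis_elt \<one> x * f y else 0)"
      using S unfolding one by (intro monoid_alg_mult_eq) (auto simp: basis_elt_def)
    also have "\<dots> = (\<Sum>y\<in>?S. if y = z then f y else 0)"
      using S(2) by (auto simp: basis_elt_def intro!: sum.cong)
    finally show "(\<one>\<^bsub>monoid_alg G\<^esub> \<otimes>\<^bsub>monoid_alg G\<^esub> f) z = f z"
      using S(1) by (simp add: sum.delta)
  qed
  show "f \<otimes>\<^bsub>monoid_alg G\<^esub> \<one>\<^bsub>monoid_alg G\<^esub> = f"
  proof
    fix z
    have "(f \<otimes>\<^bsub>monoid_alg G\<^esub> \<one>\<^bsub>monoid_alg G\<^esub>) z =
        (\<Sum>x\<in>?S. \<Sum>y\<in>{\<one>}. if x \<otimes> y = z then f x * basis_elt \<one> y else 0)"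
      using S unfolding one by (intro monoid_alg_mult_eq) (auto simp: basis_elt_def)
    also have "\<dots> = (\<Sum>x\<in>?S. if x = z then f x else 0)"
      using S(2) by (auto simp: basis_elt_def intro!: sum.cong)
    finally show "(f \<otimes>\<^bsub>monoid_alg G\<^esub> \<one>\<^bsub>monoid_alg G\<^esub>) z = f z"
      using S(1) by (simp add: sum.delta)
  qed
qed

lemma monoid_alg_add_closed:
  assumes "f \<in> carrier (monoid_alg G)" "g \<in> carrier (monoid_alg G)"
  shows "f \<oplus>\<^bsub>monoid_alg G\<^esub> g \<in> carrier (monoid_alg G)"
proof -
  have "{x. f x + g x \<noteq> 0} \<subseteq> {x. f x \<noteq> 0} \<union> {x. g x \<noteq> 0}"
    by auto
  then show ?thesis
    using assms by (auto simp: monoid_alg_def intro: finite_subset)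
qed

lemma monoid_alg_smult_closed:
  assumes "f \<in> carrier (monoid_alg G)"
  shows "c \<odot>\<^bsub>monoid_alg G\<^esub> f \<in> carrier (monoid_alg G)"
proof -
  have "{x. c * f x \<noteq> 0} \<subseteq> {x. f x \<noteq> 0}"
    by auto
  then show ?thesis
    using assms by (auto simp: monoid_alg_def intro: finite_subset)
qed

lemma monoid_alg_smult_mult:
  assumes "f \<in> carrier (monoid_alg G)" "g \<in> carrier (monoid_alg G)"
  shows "c \<odot>\<^bsub>monoid_alg G\<^esub> f \<otimes>\<^bsub>monoid_alg G\<^esub> g = c \<odot>\<^bsub>monoid_alg G\<^esub> (f \<otimes>\<^bsub>monoid_alg G\<^esub> g)"
    and "f \<otimes>\<^bsub>monoid_alg G\<^esub> (c \<odot>\<^bsub>monoid_alg G\<^esub> g) = c \<odot>\<^bsub>monoid_alg G\<^esub> (f \<otimes>\<^bsub>monoid_alg G\<^esub> g)"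
proof -
  let ?S = "{x. f x \<noteq> 0}" and ?T = "{x. g x \<noteq> 0}"
  have mult: "(k \<otimes>\<^bsub>monoid_alg G\<^esub> l) z =
      (\<Sum>x\<in>?S. \<Sum>y\<in>?T. if x \<otimes> y = z then k x * l y else 0)"
    if "{x. k x \<noteq> 0} \<subseteq> ?S" "{x. l x \<noteq> 0} \<subseteq> ?T" for k l z
    using assms that by (intro monoid_alg_mult_eq) (auto simp: monoid_alg_def)
  have sub: "{x. c * f x \<noteq> 0} \<subseteq> ?S" "{x. c * g x \<noteq> 0} \<subseteq> ?T"
    by auto
  have smult: "c \<odot>\<^bsub>monoid_alg G\<^esub> k = (\<lambda>z. c * k z)" for k
    by (simp add: monoid_alg_def)
  show "c \<odot>\<^bsub>monoid_alg G\<^esub> f \<otimes>\<^bsub>monoid_alg G\<^esub> g = c \<odot>\<^bsub>monoid_alg G\<^esub> (f \<otimes>\<^bsub>monoid_alg G\<^esub> g)"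
    unfolding smult mult[OF sub(1) subset_refl] mult[OF subset_refl subset_refl] fun_eq_iff
      sum_distrib_left
    by (auto intro!: sum.cong)
  show "f \<otimes>\<^bsub>monoid_alg G\<^esub> (c \<odot>\<^bsub>monoid_alg G\<^esub> g) = c \<odot>\<^bsub>monoid_alg G\<^esub> (f \<otimes>\<^bsub>monoid_alg G\<^esub> g)"
    unfolding smult mult[OF subset_refl sub(2)] mult[OF subset_refl subset_refl] fun_eq_iff
      sum_distrib_left
    by (auto intro!: sum.cong)
qed

lemma complex_alg_monoid_alg: "complex_alg (monoid_alg G)"
proof -
  have "abelian_group (monoid_alg G)"
  proof (rule abelian_groupI)
    fix f assume f: "f \<in> carrier (monoid_alg G)"
    then show "\<exists>g\<in>carrier (monoid_alg G). g \<oplus>\<^bsub>monoid_alg G\<^esub> f = \<zero>\<^bsub>monoid_alg G\<^esub>"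
      using monoid_alg_smult_closed[OF f, of "-1"]
      by (intro bexI[of _ "(-1) \<odot>\<^bsub>monoid_alg G\<^esub> f"]) (auto simp: monoid_alg_def)
  qed (auto simp: monoid_alg_add_closed, auto simp: monoid_alg_def algebra_simps)
  moreover have "Group.monoid (monoid_alg G)"
  proof (rule monoidI)
    show "\<one>\<^bsub>monoid_alg G\<^esub> \<in> carrier (monoid_alg G)"
      using basis_elt_closed[OF one_closed] by (simp add: monoid_alg_def basis_elt_def)
  qed (auto simp: monoid_alg_mult_closed monoid_alg_mult_assoc monoid_alg_one_mult)
  ultimately have "ring (monoid_alg G)"
    by (rule ringI) (simp_all add: monoid_alg_distr)
  moreover have "complex_alg_axioms (monoid_alg G)"
    by unfold_locales
       (simp_all add: monoid_alg_smult_closed monoid_alg_smult_mult, simp_all add: monoid_alg_def algebra_simps)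
  ultimately show ?thesis
    by (rule complex_alg.intro)
qed

end

section \<open>Quotients\<close>

lemma alg_quot_sel:
  "carrier (alg_quot A I) = carrier (A Quot I)"
  "mult (alg_quot A I) = mult (A Quot I)"
  "one (alg_quot A I) = one (A Quot I)"
  "zero (alg_quot A I) = zero (A Quot I)"
  "add (alg_quot A I) = add (A Quot I)"
  by (simp_all add: alg_quot_def)

context complex_alg
begin

text \<open>Scalars act through the central elements \<open>c \<odot> \<one>\<close>, so a ring
  ideal is automatically a linear subspace. This is why an ideal generated in the purely
  ring-theoretic sense gives a quotient algebra.\<close>

lemma ideal_smult_closed:
  assumes "ideal I A" "x \<in> I"
  shows "c \<odot> x \<in> I"
proof -
  interpret I: ideal I A by fact
  have "c \<odot> x = (c \<odot> \<one>) \<otimes> x"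
    using I.a_Hcarr[OF assms(2)] by (simp add: smult_mult_left)
  then show ?thesis
    using assms(2) I.I_l_closed by simp
qed

text \<open>Changing the representative changes \<open>c \<odot> x\<close> by an element of the
  ideal. The union in \<open>alg_quot\<close> thus runs over a constant family, and it collapses to
  one coset because \<open>I +> a\<close> is nonempty.\<close>

lemma smult_alg_quot:
  assumes "ideal I A" "a \<in> carrier A"
  shows "c \<odot>\<^bsub>alg_quot A I\<^esub> (I +> a) = I +> c \<odot> a"
proof -
  interpret I: ideal I A by fact
  have "I +> c \<odot> x = I +> c \<odot> a" if "x \<in> I +> a" for x
  proof -
    from that obtain h where h: "h \<in> I" "x = h \<oplus> a"
      by (auto simp: a_r_coset_def')
    then have "c \<odot> x = c \<odot> h \<oplus> c \<odot> a"
      using I.a_Hcarr assms(2) by (simp add: smult_r_distr)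
    then have "c \<odot> x \<in> I +> c \<odot> a"
      using ideal_smult_closed[OF assms(1) h(1)] by (auto simp: a_r_coset_def')
    then show ?thesis
      using I.a_repr_independence'[of "c \<odot> x" "c \<odot> a"] assms(2) by auto
  qed
  then have "(\<Union>x\<in>I +> a. I +> c \<odot> x) = (\<Union>x\<in>I +> a. I +> c \<odot> a)"
    by (rule SUP_cong[OF refl])
  also have "\<dots> = I +> c \<odot> a"
    using I.a_rcos_self[OF assms(2)] by (intro SUP_const) blast
  finally show ?thesis
    by (simp only: alg_quot_def module.simps)
qed

lemma carrier_alg_quot: "carrier (alg_quot A I) = (+>) I ` carrier A"
  by (auto simp: alg_quot_sel FactRing_simps)

lemma coset_alg_quot:
  assumes "ideal I A" "a \<in> carrier A" "b \<in> carrier A"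
  shows "(I +> a) \<otimes>\<^bsub>alg_quot A I\<^esub> (I +> b) = I +> a \<otimes> b"
    and "(I +> a) \<oplus>\<^bsub>alg_quot A I\<^esub> (I +> b) = I +> a \<oplus> b"
  using assms(2,3) ring_hom_mult[OF ideal.rcos_ring_hom[OF assms(1)]]
    ring_hom_add[OF ideal.rcos_ring_hom[OF assms(1)]]
  by (simp_all add: alg_quot_sel)

text \<open>\<open>A Quot I\<close> is a plain ring record without scalars, hence a different record
  from \<open>alg_quot A I\<close>. Its ring axioms are carried over field by field through
  \<open>alg_quot_sel\<close>.\<close>

lemma complex_alg_alg_quot:
  assumes "ideal I A"
  shows "complex_alg (alg_quot A I)"
proof -
  interpret I: ideal I A by fact
  interpret Q: ring "A Quot I"
    by (rule I.quotient_is_ring)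
  have "abelian_group (alg_quot A I)"
  proof (rule abelian_groupI, unfold alg_quot_sel)
    fix x assume "x \<in> carrier (A Quot I)"
    then show "\<exists>y\<in>carrier (A Quot I). y \<oplus>\<^bsub>A Quot I\<^esub> x = \<zero>\<^bsub>A Quot I\<^esub>"
      using Q.a_inv_closed Q.l_neg by blast
  qed (fact Q.a_closed Q.zero_closed Q.a_assoc Q.a_comm Q.l_zero)+
  moreover have "Group.monoid (alg_quot A I)"
    by (rule monoidI)
       (simp_all only: alg_quot_sel Q.m_closed Q.m_assoc Q.l_one Q.r_one Q.one_closed)
  ultimately have "ring (alg_quot A I)"
    by (rule ringI) (simp_all only: alg_quot_sel Q.l_distr Q.r_distr)
  moreover have "complex_alg_axioms (alg_quot A I)"
    unfolding complex_alg_axioms_def carrier_alg_quot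
    by (intro conjI allI impI; elim imageE;
        simp add: smult_alg_quot[OF assms] coset_alg_quot[OF assms] smult_r_distr smult_l_distr smult_assoc
          smult_mult_left smult_mult_right)
  ultimately show ?thesis
    by (rule complex_alg.intro)
qed

end

section \<open>Tensor products\<close>

locale alg_pair = A: complex_alg A + B: complex_alg B
  for A :: "(complex, 'a) module" and B :: "(complex, 'b) module"
begin

abbreviation "F \<equiv> monoid_alg (A \<times>\<times> B)"
abbreviation "T \<equiv> alg_tensor A B"
abbreviation "pure \<equiv> pure_tensor A B"

sublocale pairs: Group.monoid "A \<times>\<times> B"
  by (rule DirProd_monoid[OF A.monoid_axioms B.monoid_axioms])

sublocale F: complex_alg F
  by (rule pairs.complex_alg_monoid_alg)

lemma basis_elt_pair_closed:
  "a \<in> carrier A \<Longrightarrow> b \<in> carrier B \<Longrightarrow> basis_elt (a, b) \<in> carrier F"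
  by (rule pairs.basis_elt_closed) simp

lemma bilinear_rels_closed: "bilinear_rels A B \<subseteq> carrier F"
  unfolding bilinear_rels_def Let_def
  by (auto intro!: F.minus_closed F.a_closed F.smult_closed basis_elt_pair_closed)

lemma ideal_tensor_ideal: "ideal (tensor_ideal A B) F"
  unfolding tensor_ideal_def by (rule F.genideal_ideal[OF bilinear_rels_closed])

sublocale T: complex_alg T
  unfolding alg_tensor_def by (rule F.complex_alg_alg_quot[OF ideal_tensor_ideal])

lemma pure_closed [simp, intro]: "a \<in> carrier A \<Longrightarrow> b \<in> carrier B \<Longrightarrow> pure a b \<in> carrier T"
  unfolding pure_tensor_def alg_tensor_def
  by (simp add: F.carrier_alg_quot basis_elt_pair_closed)

lemma pure_mult:
  assumes "a \<in> carrier A" "b \<in> carrier B" "a' \<in> carrier A" "b' \<in> carrier B"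
  shows "pure a b \<otimes>\<^bsub>T\<^esub> pure a' b' = pure (a \<otimes>\<^bsub>A\<^esub> a') (b \<otimes>\<^bsub>B\<^esub> b')"
  using assms unfolding pure_tensor_def alg_tensor_def
  by (simp add: F.coset_alg_quot ideal_tensor_ideal basis_elt_pair_closed pairs.basis_elt_mult)

lemma one_tensor: "\<one>\<^bsub>T\<^esub> = pure \<one>\<^bsub>A\<^esub> \<one>\<^bsub>B\<^esub>"
  by (simp add: alg_tensor_def pure_tensor_def alg_quot_def FactRing_def monoid_alg_def basis_elt_def)

text \<open>The four bilinearity laws of \<open>pure\<close> below are the instances for the four
  families in \<open>bilinear_rels\<close>.\<close>

lemma coset_eq_of_rel:
  assumes "x \<ominus>\<^bsub>F\<^esub> y \<in> bilinear_rels A B" "x \<in> carrier F" "y \<in> carrier F"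
  shows "tensor_ideal A B +>\<^bsub>F\<^esub> x = tensor_ideal A B +>\<^bsub>F\<^esub> y"
proof -
  have "x \<ominus>\<^bsub>F\<^esub> y \<in> tensor_ideal A B"
    unfolding tensor_ideal_def using F.genideal_self[OF bilinear_rels_closed] assms(1) by auto
  then show ?thesis
    using F.quotient_eq_iff_same_a_r_cos[OF ideal_tensor_ideal assms(2,3)] by simp
qed

lemma pure_add_left:
  assumes "a \<in> carrier A" "a' \<in> carrier A" "b \<in> carrier B"
  shows "pure (a \<oplus>\<^bsub>A\<^esub> a') b = pure a b \<oplus>\<^bsub>T\<^esub> pure a' b"
proof -
  have "basis_elt (a \<oplus>\<^bsub>A\<^esub> a', b) \<ominus>\<^bsub>F\<^esub> (basis_elt (a, b) \<oplus>\<^bsub>F\<^esub> basis_elt (a', b))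
      \<in> bilinear_rels A B"
    unfolding bilinear_rels_def Let_def using assms by blast
  from coset_eq_of_rel[OF this] show ?thesis
    using assms unfolding pure_tensor_def alg_tensor_def
    by (simp add: F.coset_alg_quot ideal_tensor_ideal basis_elt_pair_closed)
qed

lemma pure_add_right:
  assumes "a \<in> carrier A" "b \<in> carrier B" "b' \<in> carrier B"
  shows "pure a (b \<oplus>\<^bsub>B\<^esub> b') = pure a b \<oplus>\<^bsub>T\<^esub> pure a b'"
proof -
  have "basis_elt (a, b \<oplus>\<^bsub>B\<^esub> b') \<ominus>\<^bsub>F\<^esub> (basis_elt (a, b) \<oplus>\<^bsub>F\<^esub> basis_elt (a, b'))
      \<in> bilinear_rels A B"
    unfolding bilinear_rels_def Let_def using assms by blast
  from coset_eq_of_rel[OF this] show ?thesis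
    using assms unfolding pure_tensor_def alg_tensor_def
    by (simp add: F.coset_alg_quot ideal_tensor_ideal basis_elt_pair_closed)
qed

lemma pure_smult_left:
  assumes "a \<in> carrier A" "b \<in> carrier B"
  shows "pure (c \<odot>\<^bsub>A\<^esub> a) b = c \<odot>\<^bsub>T\<^esub> pure a b"
proof -
  have "basis_elt (c \<odot>\<^bsub>A\<^esub> a, b) \<ominus>\<^bsub>F\<^esub> c \<odot>\<^bsub>F\<^esub> basis_elt (a, b) \<in> bilinear_rels A B"
    unfolding bilinear_rels_def Let_def using assms by blast
  from coset_eq_of_rel[OF this] show ?thesis
    using assms unfolding pure_tensor_def alg_tensor_def
    by (simp add: F.smult_alg_quot ideal_tensor_ideal basis_elt_pair_closed)
qed

lemma pure_smult_right:
  assumes "a \<in> carrier A" "b \<in> carrier B"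
  shows "pure a (c \<odot>\<^bsub>B\<^esub> b) = c \<odot>\<^bsub>T\<^esub> pure a b"
proof -
  have "basis_elt (a, c \<odot>\<^bsub>B\<^esub> b) \<ominus>\<^bsub>F\<^esub> c \<odot>\<^bsub>F\<^esub> basis_elt (a, b) \<in> bilinear_rels A B"
    unfolding bilinear_rels_def Let_def using assms by blast
  from coset_eq_of_rel[OF this] show ?thesis
    using assms unfolding pure_tensor_def alg_tensor_def
    by (simp add: F.smult_alg_quot ideal_tensor_ideal basis_elt_pair_closed)
qed

lemma alg_hom_pure_left: "(\<lambda>a. pure a \<one>\<^bsub>B\<^esub>) \<in> alg_hom A T"
  by (auto simp: alg_hom_def ring_hom_def pure_mult pure_add_left pure_smult_left one_tensor)

lemma alg_hom_pure_right: "(\<lambda>b. pure \<one>\<^bsub>A\<^esub> b) \<in> alg_hom B T"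
  by (auto simp: alg_hom_def ring_hom_def pure_mult pure_add_right pure_smult_right one_tensor)

lemma pure_zero_left: "b \<in> carrier B \<Longrightarrow> pure \<zero>\<^bsub>A\<^esub> b = \<zero>\<^bsub>T\<^esub>"
  using pure_add_left[of "\<zero>\<^bsub>A\<^esub>" "\<zero>\<^bsub>A\<^esub>" b] T.add.l_cancel_one'[of "pure \<zero>\<^bsub>A\<^esub> b" "pure \<zero>\<^bsub>A\<^esub> b"]
  by simp

lemma pure_zero_right: "a \<in> carrier A \<Longrightarrow> pure a \<zero>\<^bsub>B\<^esub> = \<zero>\<^bsub>T\<^esub>"
  using pure_add_right[of a "\<zero>\<^bsub>B\<^esub>" "\<zero>\<^bsub>B\<^esub>"] T.add.l_cancel_one'[of "pure a \<zero>\<^bsub>B\<^esub>" "pure a \<zero>\<^bsub>B\<^esub>"]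
  by simp

end

section \<open>Subalgebras\<close>

lemma is_subalgD:
  assumes "is_subalg Z A"
  shows "Z \<subseteq> carrier A" "\<one>\<^bsub>A\<^esub> \<in> Z"
    "\<And>x y. x \<in> Z \<Longrightarrow> y \<in> Z \<Longrightarrow> x \<otimes>\<^bsub>A\<^esub> y \<in> Z"
    "\<And>x y. x \<in> Z \<Longrightarrow> y \<in> Z \<Longrightarrow> x \<oplus>\<^bsub>A\<^esub> y \<in> Z"
    "\<And>c x. x \<in> Z \<Longrightarrow> c \<odot>\<^bsub>A\<^esub> x \<in> Z"
  using assms subringE[of Z A] by (auto simp: is_subalg_def)

context complex_alg
begin


lemma is_subalgI:
  assumes "Z \<subseteq> carrier A" "\<one> \<in> Z"
    and "\<And>x. x \<in> Z \<Longrightarrow> \<ominus> x \<in> Z"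
    and "\<And>x y. x \<in> Z \<Longrightarrow> y \<in> Z \<Longrightarrow> x \<otimes> y \<in> Z"
    and "\<And>x y. x \<in> Z \<Longrightarrow> y \<in> Z \<Longrightarrow> x \<oplus> y \<in> Z"
    and "\<And>c x. x \<in> Z \<Longrightarrow> c \<odot> x \<in> Z"
  shows "is_subalg Z A"
  using assms subringI by (auto simp: is_subalg_def)

lemma is_subalg_carrier: "is_subalg (carrier A) A"
  by (rule is_subalgI) auto

lemma subalg_gen_is_subalg:
  assumes "X \<subseteq> carrier A"
  shows "is_subalg (subalg_gen A X) A"
proof -
  have "subring (subalg_gen A X) A"
    unfolding subalg_gen_def
    using is_subalg_carrier assms by (intro subring_Inter) (auto simp: is_subalg_def)
  then show ?thesis
    by (auto simp: is_subalg_def subalg_gen_def)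
qed

lemma subalg_gen_superset: "X \<subseteq> subalg_gen A X"
  by (auto simp: subalg_gen_def)

lemma subalg_gen_minimal: "is_subalg Z A \<Longrightarrow> X \<subseteq> Z \<Longrightarrow> subalg_gen A X \<subseteq> Z"
  by (auto simp: subalg_gen_def)

text \<open>Phrased for additive submonoids rather than subalgebras, because
  \<open>is_subalg_sub_tensor\<close> uses it before the subalgebra property is available.\<close>

lemma finsum_mem:
  assumes "finite I" "Z \<subseteq> carrier A" "\<zero> \<in> Z" "\<And>x y. x \<in> Z \<Longrightarrow> y \<in> Z \<Longrightarrow> x \<oplus> y \<in> Z"
    and "\<And>i. i \<in> I \<Longrightarrow> f i \<in> Z"
  shows "(\<Oplus>i\<in>I. f i) \<in> Z"
  using assms(1,5)
proof (induction I rule: finite_induct)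
  case (insert i I)
  then have "(\<Oplus>i\<in>insert i I. f i) = f i \<oplus> (\<Oplus>i\<in>I. f i)"
    using assms(2) by (intro finsum_insert) auto
  then show ?case
    using insert assms(4) by simp
qed (simp add: assms)

end

section \<open>Sums of pure tensors with entries in two given subalgebras\<close>

context alg_pair
begin

lemma pure_in_sub_tensor:
  assumes "a \<in> X" "b \<in> Z" "X \<subseteq> carrier A" "Z \<subseteq> carrier B"
  shows "pure a b \<in> sub_tensor A B X Z"
proof -
  have "pure a b \<in> carrier T"
    using assms by auto
  then have "pure a b = (\<Oplus>\<^bsub>T\<^esub>i\<in>{..<Suc 0}. pure a b)"
    by (simp add: lessThan_Suc)
  with assms(1,2) show ?thesis
    unfolding sub_tensor_def
    by (intro CollectI exI[of _ "Suc 0"] exI[of _ "\<lambda>_. a"] exI[of _ "\<lambda>_. b"]) simp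
qed

lemma zero_in_sub_tensor: "\<zero>\<^bsub>T\<^esub> \<in> sub_tensor A B X Z"
proof -
  have "\<zero>\<^bsub>T\<^esub> = (\<Oplus>\<^bsub>T\<^esub>i\<in>{..<0::nat}. pure (undefined i) (undefined i))"
    by simp
  then show ?thesis
    unfolding sub_tensor_def by blast
qed

lemma sub_tensor_add:
  assumes "x \<in> sub_tensor A B X Z" "y \<in> sub_tensor A B X Z" "X \<subseteq> carrier A" "Z \<subseteq> carrier B"
  shows "x \<oplus>\<^bsub>T\<^esub> y \<in> sub_tensor A B X Z"
proof -
  from assms(1) obtain m a b where x: "x = (\<Oplus>\<^bsub>T\<^esub>i\<in>{..<m::nat}. pure (a i) (b i))"
    and ab: "\<And>i. i < m \<Longrightarrow> a i \<in> X \<and> b i \<in> Z"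
    unfolding sub_tensor_def by blast
  from assms(2) obtain m' a' b' where y: "y = (\<Oplus>\<^bsub>T\<^esub>i\<in>{..<m'::nat}. pure (a' i) (b' i))"
    and ab': "\<And>i. i < m' \<Longrightarrow> a' i \<in> X \<and> b' i \<in> Z"
    unfolding sub_tensor_def by blast
  have carr: "pure (a i) (b i) \<in> carrier T" if "i < m" for i
    using ab[OF that] assms(3,4) by auto
  have carr': "pure (a' i) (b' i) \<in> carrier T" if "i < m'" for i
    using ab'[OF that] assms(3,4) by auto
  \<comment> \<open>The two families are concatenated: the second one is shifted by the length
    \<open>m\<close> of the first.\<close>
  define a'' where "a'' i = (if i < m then a i else a' (i - m))" for i
  define b'' where "b'' i = (if i < m then b i else b' (i - m))" for i
  have mem: "\<forall>i<m + m'. a'' i \<in> X \<and> b'' i \<in> Z"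
    using ab ab' by (auto simp: a''_def b''_def)
  then have mem': "pure (a'' i) (b'' i) \<in> carrier T" if "i < m + m'" for i
    using assms(3,4) that by auto
  have "x = (\<Oplus>\<^bsub>T\<^esub>i\<in>{..<m}. pure (a'' i) (b'' i))"
    unfolding x using carr by (intro T.finsum_cong') (auto simp: a''_def b''_def)
  moreover have "y = (\<Oplus>\<^bsub>T\<^esub>i\<in>(\<lambda>i. m + i) ` {..<m'}. pure (a'' i) (b'' i))"
    unfolding y using carr'
    by (subst T.finsum_reindex) (auto simp: a''_def b''_def intro!: T.finsum_cong')
  moreover have "{..<m + m'} = {..<m} \<union> (\<lambda>i. m + i) ` {..<m'}"
  proof -
    have "x \<in> (\<lambda>i. m + i) ` {..<m'}" if "\<not> x < m" "x < m + m'" for x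
      using that by (intro image_eqI[of _ _ "x - m"]) auto
    then show ?thesis
      by auto
  qed
  ultimately have "x \<oplus>\<^bsub>T\<^esub> y = (\<Oplus>\<^bsub>T\<^esub>i\<in>{..<m + m'}. pure (a'' i) (b'' i))"
    using mem' by (simp only:) (subst T.finsum_Un_disjoint; auto)
  then show ?thesis
    unfolding sub_tensor_def using mem by blast
qed

text \<open>Closure under products is the substantial part: a product of two sums expands into
  products of pure tensors, taken componentwise. Scalar multiples and negatives then follow, being
  products with the pure tensors that represent \<open>c \<odot> \<one>\<close> and
  \<open>\<ominus> \<one>\<close>.\<close>

lemma is_subalg_sub_tensor:
  assumes "is_subalg X A" "is_subalg Z B"
  shows "is_subalg (sub_tensor A B X Z) T"
proof -
  note X = is_subalgD[OF assms(1)] and Z = is_subalgD[OF assms(2)]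
  let ?S = "sub_tensor A B X Z"
  have sub: "?S \<subseteq> carrier T"
    unfolding sub_tensor_def using X(1) Z(1) by (auto intro!: T.finsum_closed pure_closed)
  have sum: "(\<Oplus>\<^bsub>T\<^esub>i\<in>I. f i) \<in> ?S" if "finite I" "\<And>i. i \<in> I \<Longrightarrow> f i \<in> ?S" for I :: "nat set" and f
    using that sub zero_in_sub_tensor sub_tensor_add[OF _ _ X(1) Z(1)] by (intro T.finsum_mem) auto
  have mult: "x \<otimes>\<^bsub>T\<^esub> y \<in> ?S" if "x \<in> ?S" "y \<in> ?S" for x y
  proof -
    from that(1) obtain m a b where x: "x = (\<Oplus>\<^bsub>T\<^esub>i\<in>{..<m::nat}. pure (a i) (b i))"
      and ab: "\<And>i. i < m \<Longrightarrow> a i \<in> X \<and> b i \<in> Z"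
      unfolding sub_tensor_def by blast
    from that(2) obtain m' a' b' where y: "y = (\<Oplus>\<^bsub>T\<^esub>i\<in>{..<m'::nat}. pure (a' i) (b' i))"
      and ab': "\<And>i. i < m' \<Longrightarrow> a' i \<in> X \<and> b' i \<in> Z"
      unfolding sub_tensor_def by blast
    have 1: "pure (a i) (b i) \<in> carrier T" if "i < m" for i
      using ab[OF that] X(1) Z(1) by auto
    have 2: "pure (a' i) (b' i) \<in> carrier T" if "i < m'" for i
      using ab'[OF that] X(1) Z(1) by auto
    have "x \<otimes>\<^bsub>T\<^esub> y = (\<Oplus>\<^bsub>T\<^esub>i\<in>{..<m}. pure (a i) (b i) \<otimes>\<^bsub>T\<^esub> y)"
      unfolding x using 1 sub that(2) by (intro T.finsum_ldistr) auto
    also have "\<dots> \<in> ?S"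
    proof (rule sum)
      fix i assume i: "i \<in> {..<m}"
      have "pure (a i) (b i) \<otimes>\<^bsub>T\<^esub> y = (\<Oplus>\<^bsub>T\<^esub>j\<in>{..<m'}. pure (a i) (b i) \<otimes>\<^bsub>T\<^esub> pure (a' j) (b' j))"
        unfolding y using 1 2 i by (intro T.finsum_rdistr) auto
      also have "\<dots> \<in> ?S"
      proof (rule sum)
        fix j assume j: "j \<in> {..<m'}"
        have "pure (a i) (b i) \<otimes>\<^bsub>T\<^esub> pure (a' j) (b' j) =
            pure (a i \<otimes>\<^bsub>A\<^esub> a' j) (b i \<otimes>\<^bsub>B\<^esub> b' j)"
          using i j ab[of i] ab'[of j] X(1) Z(1) by (intro pure_mult) auto
        then show "pure (a i) (b i) \<otimes>\<^bsub>T\<^esub> pure (a' j) (b' j) \<in> ?S"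
          using i j ab[of i] ab'[of j] X Z pure_in_sub_tensor by simp
      qed simp
      finally show "pure (a i) (b i) \<otimes>\<^bsub>T\<^esub> y \<in> ?S" .
    qed simp
    finally show ?thesis .
  qed
  have one: "\<one>\<^bsub>T\<^esub> \<in> ?S"
    using X Z by (simp add: one_tensor pure_in_sub_tensor)
  have smult: "c \<odot>\<^bsub>T\<^esub> x \<in> ?S" if "x \<in> ?S" for c x
  proof -
    have "c \<odot>\<^bsub>T\<^esub> \<one>\<^bsub>T\<^esub> = pure (c \<odot>\<^bsub>A\<^esub> \<one>\<^bsub>A\<^esub>) \<one>\<^bsub>B\<^esub>"
      by (simp add: one_tensor pure_smult_left)
    then have "c \<odot>\<^bsub>T\<^esub> \<one>\<^bsub>T\<^esub> \<in> ?S"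
      using X Z pure_in_sub_tensor by simp
    moreover have "c \<odot>\<^bsub>T\<^esub> x = c \<odot>\<^bsub>T\<^esub> \<one>\<^bsub>T\<^esub> \<otimes>\<^bsub>T\<^esub> x"
      using that sub by (auto simp: T.smult_mult_left)
    ultimately show ?thesis
      using mult that by simp
  qed
  have minus: "\<ominus>\<^bsub>T\<^esub> x \<in> ?S" if "x \<in> ?S" for x
  proof -
    have "\<ominus>\<^bsub>A\<^esub> \<one>\<^bsub>A\<^esub> \<in> X"
      using assms(1) X(2) subringE(5)[of X A] by (simp add: is_subalg_def)
    then have "pure (\<ominus>\<^bsub>A\<^esub> \<one>\<^bsub>A\<^esub>) \<one>\<^bsub>B\<^esub> \<in> ?S"
      using X Z pure_in_sub_tensor by simp
    moreover have "pure (\<ominus>\<^bsub>A\<^esub> \<one>\<^bsub>A\<^esub>) \<one>\<^bsub>B\<^esub> = \<ominus>\<^bsub>T\<^esub> \<one>\<^bsub>T\<^esub>"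
      using pure_add_left[of "\<ominus>\<^bsub>A\<^esub> \<one>\<^bsub>A\<^esub>" "\<one>\<^bsub>A\<^esub>" "\<one>\<^bsub>B\<^esub>"]
      by (intro T.minus_equality[symmetric]) (auto simp: one_tensor pure_zero_left A.l_neg)
    moreover have "\<ominus>\<^bsub>T\<^esub> x = \<ominus>\<^bsub>T\<^esub> \<one>\<^bsub>T\<^esub> \<otimes>\<^bsub>T\<^esub> x"
      using that sub by (auto simp: T.l_minus)
    ultimately show ?thesis
      using mult that by simp
  qed
  show ?thesis
    using sub one minus mult sub_tensor_add[OF _ _ X(1) Z(1)] smult by (rule T.is_subalgI)
qed

end

section \<open>Formal series\<close>

lemma series_ring_sel:
  "carrier (series_ring A) = {f. \<forall>r. f r \<in> carrier A}"
  "f \<otimes>\<^bsub>series_ring A\<^esub> g = (\<lambda>r. \<Oplus>\<^bsub>A\<^esub>a\<in>{..r}. f a \<otimes>\<^bsub>A\<^esub> g (r - a))"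
  "\<one>\<^bsub>series_ring A\<^esub> = (\<lambda>r. if r = 0 then \<one>\<^bsub>A\<^esub> else \<zero>\<^bsub>A\<^esub>)"
  "\<zero>\<^bsub>series_ring A\<^esub> = (\<lambda>_. \<zero>\<^bsub>A\<^esub>)"
  "f \<oplus>\<^bsub>series_ring A\<^esub> g = (\<lambda>r. f r \<oplus>\<^bsub>A\<^esub> g r)"
  by (simp_all add: series_ring_def)

context complex_alg
begin

lemma const_series_closed: "const_series A c \<in> carrier (series_ring A)"
  by (simp add: series_ring_sel const_series_def)

lemma series_mult_assoc:
  fixes f g h :: "nat \<Rightarrow> 'a"
  assumes f: "\<And>r. f r \<in> carrier A" and g: "\<And>r. g r \<in> carrier A" and h: "\<And>r. h r \<in> carrier A"
  shows "(\<Oplus>j\<in>{..n}. (\<Oplus>i\<in>{..j}. f i \<otimes> g (j - i)) \<otimes> h (n - j)) =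
    (\<Oplus>j\<in>{..n}. f j \<otimes> (\<Oplus>i\<in>{..n - j}. g i \<otimes> h (n - j - i)))"
proof -
  \<comment> \<open>The summation bound \<open>k\<close> is separated from the total degree
    \<open>n\<close>, which stays fixed in the index of \<open>h\<close>; with \<open>k = n\<close>
    throughout the induction would not go through. Both sides range over the pairs of indices of
    \<open>f\<close> and \<open>g\<close> with sum at most \<open>k\<close>.\<close>
  have "k \<le> n \<Longrightarrow> (\<Oplus>j\<in>{..k}. (\<Oplus>i\<in>{..j}. f i \<otimes> g (j - i)) \<otimes> h (n - j)) =
    (\<Oplus>j\<in>{..k}. f j \<otimes> (\<Oplus>i\<in>{..k - j}. g i \<otimes> h (n - j - i)))" (is "_ \<Longrightarrow> ?eq k") for k
  proof (induction k)
    case 0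
    then show ?case
      using f g h by (simp add: Pi_def m_assoc)
  next
    case (Suc k)
    then have "?eq k"
      by simp
    with f g h Suc.prems show ?case
      by (simp cong: finsum_cong add: Suc_diff_le Pi_def l_distr r_distr m_assoc)
         (simp cong: finsum_cong add: Pi_def a_ac finsum_ldistr m_assoc)
  qed
  then show ?thesis
    by simp
qed

lemma series_mult_const_right:
  assumes "f \<in> carrier (series_ring A)"
  shows "f \<otimes>\<^bsub>series_ring A\<^esub> const_series A c = (\<lambda>r. c \<odot> f r)"
proof
  fix r
  have f: "f a \<in> carrier A" for a
    using assms by (simp add: series_ring_sel)
  have "(f \<otimes>\<^bsub>series_ring A\<^esub> const_series A c) r = (\<Oplus>a\<in>{..r}. if a = r then c \<odot> f r else \<zero>)"
    unfolding series_ring_sel const_series_def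
    using f by (intro finsum_cong') (auto simp: smult_mult_right)
  also have "\<dots> = c \<odot> f r"
    using f finsum_singleton[of r "{..r}" "\<lambda>a. c \<odot> f r"] by (simp add: eq_commute[of r])
  finally show "(f \<otimes>\<^bsub>series_ring A\<^esub> const_series A c) r = c \<odot> f r" .
qed

text \<open>Reflecting the index by \<open>a \<mapsto> r - a\<close> reverses a convolution.
  Commutation is assumed for the coefficients of these two series alone, since it is applied inside
  noncommutative algebras: to constants, and to series from opposite legs of a tensor
  product.\<close>

lemma series_mult_commute:
  fixes f g :: "nat \<Rightarrow> 'a"
  assumes "f \<in> carrier (series_ring A)" "g \<in> carrier (series_ring A)"
    and "\<And>a b. f a \<otimes> g b = g b \<otimes> f a"
  shows "f \<otimes>\<^bsub>series_ring A\<^esub> g = g \<otimes>\<^bsub>series_ring A\<^esub> f"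
proof
  fix r :: nat
  have carr: "f a \<in> carrier A" "g a \<in> carrier A" for a
    using assms by (simp_all add: series_ring_sel)
  have bij: "(\<lambda>a. r - a) ` {..r} = {..r}"
  proof -
    have "x \<in> (\<lambda>a. r - a) ` {..r}" if "x \<le> r" for x
      using that by (intro image_eqI[of _ _ "r - x"]) auto
    then show ?thesis
      by auto
  qed
  have "(f \<otimes>\<^bsub>series_ring A\<^esub> g) r = (\<Oplus>a\<in>(\<lambda>a. r - a) ` {..r}. g (r - a) \<otimes> f a)"
    by (simp add: bij series_ring_sel assms(3))
  also have "\<dots> = (\<Oplus>a\<in>{..r}. g (r - (r - a)) \<otimes> f (r - a))"
    using carr by (intro finsum_reindex) (auto simp: inj_on_def)
  also have "\<dots> = (g \<otimes>\<^bsub>series_ring A\<^esub> f) r"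
    unfolding series_ring_sel using carr by (intro finsum_cong') auto
  finally show "(f \<otimes>\<^bsub>series_ring A\<^esub> g) r = (g \<otimes>\<^bsub>series_ring A\<^esub> f) r" .
qed

lemma const_series_commute:
  assumes "f \<in> carrier (series_ring A)"
  shows "const_series A c \<otimes>\<^bsub>series_ring A\<^esub> f = f \<otimes>\<^bsub>series_ring A\<^esub> const_series A c"
  using assms
  by (intro series_mult_commute const_series_closed)
     (auto simp: const_series_def series_ring_sel smult_mult_left smult_mult_right)

lemma ring_series_ring: "ring (series_ring A)"
proof (rule ringI)
  show "abelian_group (series_ring A)"
  proof (rule abelian_groupI)
    fix f assume "f \<in> carrier (series_ring A)"
    then show "\<exists>g\<in>carrier (series_ring A). g \<oplus>\<^bsub>series_ring A\<^esub> f = \<zero>\<^bsub>series_ring A\<^esub>"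
      by (intro bexI[of _ "\<lambda>r. \<ominus> f r"]) (auto simp: series_ring_sel l_neg)
  qed (auto simp: series_ring_sel a_ac)
  \<comment> \<open>Viewing the unit as a constant series reduces both unit laws to
    \<open>series_mult_const_right\<close> and \<open>const_series_commute\<close>.\<close>
  have one: "\<one>\<^bsub>series_ring A\<^esub> = const_series A 1"
    by (simp add: series_ring_sel const_series_def fun_eq_iff)
  show "Group.monoid (series_ring A)"
  proof (rule monoidI)
    fix f g h
    assume "f \<in> carrier (series_ring A)" "g \<in> carrier (series_ring A)" "h \<in> carrier (series_ring A)"
    then show "f \<otimes>\<^bsub>series_ring A\<^esub> g \<otimes>\<^bsub>series_ring A\<^esub> h =
        f \<otimes>\<^bsub>series_ring A\<^esub> (g \<otimes>\<^bsub>series_ring A\<^esub> h)"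
      unfolding series_ring_sel by (intro ext series_mult_assoc) auto
  next
    fix f assume f: "f \<in> carrier (series_ring A)"
    then have "f r \<in> carrier A" for r
      by (simp add: series_ring_sel)
    then show "f \<otimes>\<^bsub>series_ring A\<^esub> \<one>\<^bsub>series_ring A\<^esub> = f"
      "\<one>\<^bsub>series_ring A\<^esub> \<otimes>\<^bsub>series_ring A\<^esub> f = f"
      unfolding one by (simp_all add: const_series_commute[OF f] series_mult_const_right[OF f])
  next
    show "\<one>\<^bsub>series_ring A\<^esub> \<in> carrier (series_ring A)"
      unfolding one by (rule const_series_closed)
  qed (auto simp: series_ring_sel intro!: finsum_closed)
qed (auto simp: series_ring_sel l_distr r_distr finsum_addf Pi_def cong: finsum_cong)

text \<open>Links identities of series, the form in which coproducts are given, with single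
  coefficients, where constant terms and membership in a subalgebra are read off.\<close>

lemma finsum_series_nth:
  assumes "finite I" "\<And>i. i \<in> I \<Longrightarrow> f i \<in> carrier (series_ring A)"
  shows "(\<Oplus>\<^bsub>series_ring A\<^esub>i\<in>I. f i) r = (\<Oplus>i\<in>I. f i r)"
proof -
  interpret S: ring "series_ring A"
    by (rule ring_series_ring)
  show ?thesis
    using assms
  proof (induction I rule: finite_induct)
    case (insert i I)
    then have "f j r \<in> carrier A" if "j \<in> insert i I" for j
      using that by (auto simp: series_ring_sel)
    moreover have "(\<Oplus>\<^bsub>series_ring A\<^esub>i\<in>insert i I. f i) = f i \<oplus>\<^bsub>series_ring A\<^esub> (\<Oplus>\<^bsub>series_ring A\<^esub>i\<in>I. f i)"
      using insert by (intro S.finsum_insert) auto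
    ultimately show ?case
      using insert by (simp add: series_ring_sel)
  qed (simp add: series_ring_sel)
qed

end

lemma alg_hom_series:
  assumes "complex_alg A" "complex_alg B" "h \<in> alg_hom A B"
  shows "ring_hom_ring (series_ring A) (series_ring B) (\<lambda>f r. h (f r))"
proof -
  interpret A: complex_alg A by fact
  interpret B: complex_alg B by fact
  have h: "h \<in> ring_hom A B"
    using assms(3) by (simp add: alg_hom_def)
  interpret h: ring_hom_ring A B h
    by (rule ring_hom_ringI2[OF A.ring_axioms B.ring_axioms h])
  show ?thesis
    by (rule ring_hom_ringI[OF A.ring_series_ring B.ring_series_ring])
       (auto simp: series_ring_sel fun_eq_iff Pi_def h.hom_finsum o_def intro!: B.finsum_cong')
qed

lemma alg_hom_const_series:
  assumes "complex_alg A" "complex_alg B" "h \<in> alg_hom A B"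
  shows "(\<lambda>r. h (const_series A c r)) = const_series B c"
proof -
  interpret A: complex_alg A by fact
  interpret B: complex_alg B by fact
  have h: "h \<in> ring_hom A B" and smult: "\<And>x. x \<in> carrier A \<Longrightarrow> h (c \<odot>\<^bsub>A\<^esub> x) = c \<odot>\<^bsub>B\<^esub> h x"
    using assms(3) by (simp_all add: alg_hom_def)
  show ?thesis
    using smult[of "\<one>\<^bsub>A\<^esub>"] ring_hom_one[OF h] ring_hom_zero[OF h A.ring_axioms B.ring_axioms]
    by (auto simp: const_series_def)
qed

section \<open>Series over a tensor product of algebras\<close>

context alg_pair
begin

abbreviation ser_left where "ser_left f \<equiv> \<lambda>r::nat. pure (f r) \<one>\<^bsub>B\<^esub>"
abbreviation ser_right where "ser_right g \<equiv> \<lambda>r::nat. pure \<one>\<^bsub>A\<^esub> (g r)"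

sublocale SA: ring "series_ring A" by (rule A.ring_series_ring)
sublocale SB: ring "series_ring B" by (rule B.ring_series_ring)
sublocale ST: ring "series_ring T" by (rule T.ring_series_ring)

sublocale ser_left: ring_hom_ring "series_ring A" "series_ring T" "\<lambda>f. ser_left f"
  by (rule alg_hom_series[OF A.complex_alg_axioms T.complex_alg_axioms alg_hom_pure_left])

sublocale ser_right: ring_hom_ring "series_ring B" "series_ring T" "\<lambda>g. ser_right g"
  by (rule alg_hom_series[OF B.complex_alg_axioms T.complex_alg_axioms alg_hom_pure_right])

lemma series_tensor_eq:
  assumes "f \<in> carrier (series_ring A)" "g \<in> carrier (series_ring B)"
  shows "series_tensor A B f g = ser_left f \<otimes>\<^bsub>series_ring T\<^esub> ser_right g"
  using assms by (simp add: series_tensor_def series_ring_sel pure_mult)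

lemma ser_left_right_commute:
  assumes "f \<in> carrier (series_ring A)" "g \<in> carrier (series_ring B)"
  shows "ser_left f \<otimes>\<^bsub>series_ring T\<^esub> ser_right g = ser_right g \<otimes>\<^bsub>series_ring T\<^esub> ser_left f"
  using assms by (intro T.series_mult_commute) (auto simp: series_ring_sel pure_mult)

lemma series_tensor_closed:
  assumes "f \<in> carrier (series_ring A)" "g \<in> carrier (series_ring B)"
  shows "series_tensor A B f g \<in> carrier (series_ring T)"
  using assms by (simp add: series_tensor_eq)

text \<open>Of the four factors only the inner two, \<open>g\<close> in the right leg and
  \<open>f'\<close> in the left, are exchanged. Each leg therefore keeps its own order of
  multiplication.\<close>

lemma series_tensor_mult:
  assumes "f \<in> carrier (series_ring A)" "g \<in> carrier (series_ring B)"
    and "f' \<in> carrier (series_ring A)" "g' \<in> carrier (series_ring B)"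
  shows "series_tensor A B f g \<otimes>\<^bsub>series_ring T\<^esub> series_tensor A B f' g' =
    series_tensor A B (f \<otimes>\<^bsub>series_ring A\<^esub> f') (g \<otimes>\<^bsub>series_ring B\<^esub> g')"
proof -
  have "series_tensor A B f g \<otimes>\<^bsub>series_ring T\<^esub> series_tensor A B f' g' =
      ser_left f \<otimes>\<^bsub>series_ring T\<^esub> (ser_right g \<otimes>\<^bsub>series_ring T\<^esub> ser_left f') \<otimes>\<^bsub>series_ring T\<^esub> ser_right g'"
    using assms by (simp add: series_tensor_eq ST.m_assoc)
  also have "\<dots> =
      ser_left f \<otimes>\<^bsub>series_ring T\<^esub> (ser_left f' \<otimes>\<^bsub>series_ring T\<^esub> ser_right g) \<otimes>\<^bsub>series_ring T\<^esub> ser_right g'"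
    using assms by (simp only: ser_left_right_commute)
  also have "\<dots> = series_tensor A B (f \<otimes>\<^bsub>series_ring A\<^esub> f') (g \<otimes>\<^bsub>series_ring B\<^esub> g')"
    using assms by (simp add: series_tensor_eq ST.m_assoc)
  finally show ?thesis .
qed

text \<open>A scalar may be absorbed by either leg. The right one is chosen because the entries of G
  have to end up inside the copy of S that forms there.\<close>

lemma series_tensor_mult_const:
  assumes "f \<in> carrier (series_ring A)" "g \<in> carrier (series_ring B)"
  shows "series_tensor A B f g \<otimes>\<^bsub>series_ring T\<^esub> const_series T c =
    series_tensor A B f (g \<otimes>\<^bsub>series_ring B\<^esub> const_series B c)"
proof -
  have "const_series T c = ser_right (const_series B c)"
    using alg_hom_const_series[OF B.complex_alg_axioms T.complex_alg_axioms alg_hom_pure_right] by simp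
  then show ?thesis
    using assms B.const_series_closed by (simp add: series_tensor_eq ST.m_assoc)
qed

lemma series_tensor_finsum_right:
  assumes "finite I" "f \<in> carrier (series_ring A)" "\<And>i. i \<in> I \<Longrightarrow> g i \<in> carrier (series_ring B)"
  shows "series_tensor A B f (\<Oplus>\<^bsub>series_ring B\<^esub>i\<in>I. g i) =
    (\<Oplus>\<^bsub>series_ring T\<^esub>i\<in>I. series_tensor A B f (g i))"
proof -
  have "series_tensor A B f (\<Oplus>\<^bsub>series_ring B\<^esub>i\<in>I. g i) =
      ser_left f \<otimes>\<^bsub>series_ring T\<^esub> (\<Oplus>\<^bsub>series_ring T\<^esub>i\<in>I. ser_right (g i))"
    using assms ser_right.hom_finsum[of g I] by (simp add: series_tensor_eq Pi_def o_def)
  also have "\<dots> = (\<Oplus>\<^bsub>series_ring T\<^esub>i\<in>I. ser_left f \<otimes>\<^bsub>series_ring T\<^esub> ser_right (g i))"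
    using assms by (intro ST.finsum_rdistr) auto
  also have "\<dots> = (\<Oplus>\<^bsub>series_ring T\<^esub>i\<in>I. series_tensor A B f (g i))"
    using assms by (intro ST.finsum_cong') (auto simp: series_tensor_eq)
  finally show ?thesis .
qed

end

section \<open>The quantum affine algebra\<close>

lemma monoid_word_monoid: "Group.monoid (word_monoid X)"
  by (rule monoidI) (auto simp: word_monoid_def)

lemma complex_alg_free_alg: "complex_alg (free_alg X)"
  unfolding free_alg_def by (rule monoid.complex_alg_monoid_alg[OF monoid_word_monoid])

lemma word_closed: "w \<in> lists X \<Longrightarrow> basis_elt w \<in> carrier (free_alg X)"
  unfolding free_alg_def
  by (rule monoid.basis_elt_closed[OF monoid_word_monoid]) (simp add: word_monoid_def)

context complex_alg
begin

lemma poly_act_closed: "(\<And>m p. F m p \<in> carrier A) \<Longrightarrow> poly_act A P F m p \<in> carrier A"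
  unfolding poly_act_def by (intro finsum_closed Pi_I smult_closed)

text \<open>Keeping \<open>X\<close> and \<open>Y\<close> general covers the three families of RTT
  relations at once. Lying in the carrier is what entitles the relations to
  \<open>genideal_ideal\<close> and \<open>genideal_self\<close>.\<close>

lemma rtt_rels_closed:
  assumes "\<And>i j m. i \<in> {1..N} \<Longrightarrow> j \<in> {1..N} \<Longrightarrow> X i j m \<in> carrier A"
    and "\<And>i j m. i \<in> {1..N} \<Longrightarrow> j \<in> {1..N} \<Longrightarrow> Y i j m \<in> carrier A"
  shows "rtt_rels A N q X Y \<subseteq> carrier A"
proof
  fix x assume "x \<in> rtt_rels A N q X Y"
  then obtain i j k l m p where ix: "i \<in> {1..N}" "j \<in> {1..N}" "k \<in> {1..N}" "l \<in> {1..N}"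
    and x: "x = rtt_left A N q X Y i j k l m p \<ominus> rtt_right A N q X Y i j k l m p"
    unfolding rtt_rels_def by blast
  have "rtt_left A N q X Y i j k l m p \<in> carrier A"
    unfolding rtt_left_def
    using ix assms by (intro finsum_closed Pi_I poly_act_closed m_closed) blast+
  moreover have "rtt_right A N q X Y i j k l m p \<in> carrier A"
    unfolding rtt_right_def
    using ix assms by (intro finsum_closed Pi_I poly_act_closed m_closed) blast+
  ultimately show "x \<in> carrier A"
    unfolding x by (rule minus_closed)
qed

end

section \<open>Generating series and the relations of order zero in the quotient\<close>

context
  fixes N :: nat and q :: complex
begin

interpretation F: complex_alg "free_alg (gens N)"
  by (rule complex_alg_free_alg)

lemma word_t_closed: "i \<in> {1..N} \<Longrightarrow> j \<in> {1..N} \<Longrightarrow> word_t i j r \<in> carrier (free_alg (gens N))"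
  by (rule word_closed) (auto simp: gens_def)

lemma word_tbar_closed: "i \<in> {1..N} \<Longrightarrow> j \<in> {1..N} \<Longrightarrow> word_tbar i j r \<in> carrier (free_alg (gens N))"
  by (rule word_closed) (auto simp: gens_def)

lemma zero_free_alg: "\<zero>\<^bsub>free_alg X\<^esub> = (\<lambda>_. 0)"
  by (simp add: free_alg_def monoid_alg_def)

lemma Tmat_closed: "i \<in> {1..N} \<Longrightarrow> j \<in> {1..N} \<Longrightarrow> Tmat i j m \<in> carrier (free_alg (gens N))"
  using F.zero_closed word_t_closed by (simp add: Tmat_def zero_free_alg)

lemma Tbarmat_closed: "i \<in> {1..N} \<Longrightarrow> j \<in> {1..N} \<Longrightarrow> Tbarmat i j m \<in> carrier (free_alg (gens N))"
  using F.zero_closed word_tbar_closed by (simp add: Tbarmat_def zero_free_alg)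

lemma Uq_rels_closed: "Uq_rels N q \<subseteq> carrier (free_alg (gens N))"
  unfolding Uq_rels_def Let_def
  by (intro Un_least F.rtt_rels_closed Tmat_closed Tbarmat_closed)
     (auto intro!: word_t_closed word_tbar_closed F.minus_closed F.m_closed)

lemma ideal_Uq_ideal: "ideal (Uq_ideal N q) (free_alg (gens N))"
  unfolding Uq_ideal_def by (rule F.genideal_ideal[OF Uq_rels_closed])

lemma complex_alg_Uq: "complex_alg (Uq N q)"
  unfolding Uq_def by (rule F.complex_alg_alg_quot[OF ideal_Uq_ideal])

lemma t_ser_closed: "i \<in> {1..N} \<Longrightarrow> j \<in> {1..N} \<Longrightarrow> t_ser N q i j \<in> carrier (series_ring (Uq N q))"
  by (auto simp: series_ring_sel Uq_def F.carrier_alg_quot t_ser_def word_t_closed)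

lemma tbar_ser_closed: "i \<in> {1..N} \<Longrightarrow> j \<in> {1..N} \<Longrightarrow> tbar_ser N q i j \<in> carrier (series_ring (Uq N q))"
  by (auto simp: series_ring_sel Uq_def F.carrier_alg_quot tbar_ser_def word_tbar_closed)

lemma Uq_ideal_rel: "x \<in> Uq_rels N q \<Longrightarrow> x \<in> Uq_ideal N q"
  unfolding Uq_ideal_def using F.genideal_self[OF Uq_rels_closed] by blast

lemma Uq_coset_eq:
  assumes "x \<ominus>\<^bsub>free_alg (gens N)\<^esub> y \<in> Uq_rels N q"
    and "x \<in> carrier (free_alg (gens N))" "y \<in> carrier (free_alg (gens N))"
  shows "Uq_ideal N q +>\<^bsub>free_alg (gens N)\<^esub> x = Uq_ideal N q +>\<^bsub>free_alg (gens N)\<^esub> y"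
  using F.quotient_eq_iff_same_a_r_cos[OF ideal_Uq_ideal assms(2,3)] Uq_ideal_rel[OF assms(1)]
  by blast

lemma zero_Uq: "\<zero>\<^bsub>Uq N q\<^esub> = Uq_ideal N q"
  by (simp add: Uq_def alg_quot_def FactRing_def)

lemma one_Uq: "\<one>\<^bsub>Uq N q\<^esub> = Uq_ideal N q +>\<^bsub>free_alg (gens N)\<^esub> \<one>\<^bsub>free_alg (gens N)\<^esub>"
  by (simp add: Uq_def alg_quot_def FactRing_def)

lemma t_ser_upper_zero:
  assumes "i \<in> {1..N}" "j \<in> {1..N}" "i < j"
  shows "t_ser N q i j 0 = \<zero>\<^bsub>Uq N q\<^esub>"
proof -
  interpret I: ideal "Uq_ideal N q" "free_alg (gens N)"
    by (rule ideal_Uq_ideal)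
  have "word_t i j 0 \<in> Uq_rels N q"
    unfolding Uq_rels_def Let_def using assms by blast
  then show ?thesis
    unfolding t_ser_def zero_Uq by (intro I.a_rcos_const Uq_ideal_rel)
qed

lemma tbar_ser_lower_zero:
  assumes "i \<in> {1..N}" "j \<in> {1..N}" "i < j"
  shows "tbar_ser N q j i 0 = \<zero>\<^bsub>Uq N q\<^esub>"
proof -
  interpret I: ideal "Uq_ideal N q" "free_alg (gens N)"
    by (rule ideal_Uq_ideal)
  have "word_tbar j i 0 \<in> Uq_rels N q"
    unfolding Uq_rels_def Let_def using assms by blast
  then show ?thesis
    unfolding tbar_ser_def zero_Uq by (intro I.a_rcos_const Uq_ideal_rel)
qed

lemma t_ser_tbar_ser_inverse:
  assumes "i \<in> {1..N}"
  shows "t_ser N q i i 0 \<otimes>\<^bsub>Uq N q\<^esub> tbar_ser N q i i 0 = \<one>\<^bsub>Uq N q\<^esub>"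
    and "tbar_ser N q i i 0 \<otimes>\<^bsub>Uq N q\<^esub> t_ser N q i i 0 = \<one>\<^bsub>Uq N q\<^esub>"
proof -
  let ?F = "free_alg (gens N)"
  have t: "word_t i i 0 \<in> carrier ?F" "word_tbar i i 0 \<in> carrier ?F"
    using assms by (simp_all add: word_t_closed word_tbar_closed)
  have "word_t i i 0 \<otimes>\<^bsub>?F\<^esub> word_tbar i i 0 \<ominus>\<^bsub>?F\<^esub> \<one>\<^bsub>?F\<^esub> \<in> Uq_rels N q"
    unfolding Uq_rels_def Let_def using assms by blast
  then have "Uq_ideal N q +>\<^bsub>?F\<^esub> (word_t i i 0 \<otimes>\<^bsub>?F\<^esub> word_tbar i i 0) = Uq_ideal N q +>\<^bsub>?F\<^esub> \<one>\<^bsub>?F\<^esub>"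
    using t by (intro Uq_coset_eq) auto
  then show "t_ser N q i i 0 \<otimes>\<^bsub>Uq N q\<^esub> tbar_ser N q i i 0 = \<one>\<^bsub>Uq N q\<^esub>"
    unfolding t_ser_def tbar_ser_def one_Uq by (simp add: Uq_def F.coset_alg_quot[OF ideal_Uq_ideal] t)
  have "word_tbar i i 0 \<otimes>\<^bsub>?F\<^esub> word_t i i 0 \<ominus>\<^bsub>?F\<^esub> \<one>\<^bsub>?F\<^esub> \<in> Uq_rels N q"
    unfolding Uq_rels_def Let_def using assms by blast
  then have "Uq_ideal N q +>\<^bsub>?F\<^esub> (word_tbar i i 0 \<otimes>\<^bsub>?F\<^esub> word_t i i 0) = Uq_ideal N q +>\<^bsub>?F\<^esub> \<one>\<^bsub>?F\<^esub>"
    using t by (intro Uq_coset_eq) auto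
  then show "tbar_ser N q i i 0 \<otimes>\<^bsub>Uq N q\<^esub> t_ser N q i i 0 = \<one>\<^bsub>Uq N q\<^esub>"
    unfolding t_ser_def tbar_ser_def one_Uq by (simp add: Uq_def F.coset_alg_quot[OF ideal_Uq_ideal] t)
qed

end

section \<open>Coproducts\<close>

lemma (in complex_alg) mat_prod_series_closed:
  assumes "\<And>i j. i \<in> {1..N} \<Longrightarrow> j \<in> {1..N} \<Longrightarrow> X i j \<in> carrier (series_ring A)"
    and "\<And>i j. i \<in> {1..N} \<Longrightarrow> j \<in> {1..N} \<Longrightarrow> Y i j \<in> carrier (series_ring A)"
    and "i \<in> {1..N}" "j \<in> {1..N}"
  shows "mat_prod (series_ring A) N X Y i j \<in> carrier (series_ring A)"
proof -
  interpret S: ring "series_ring A"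
    by (rule ring_series_ring)
  show ?thesis
    unfolding mat_prod_def using assms by (intro S.finsum_closed) auto
qed

text \<open>Written out, the left side is the sum over \<open>a\<close>, \<open>b\<close>,
  \<open>k\<close>, \<open>l\<close> of \<open>X i k \<otimes> X k a\<close> times
  \<open>G a b\<close> times \<open>Y j l \<otimes> Y l b\<close>. Multiplying leg by leg gives
  \<open>X i k * Y j l\<close> on the left and \<open>X k a * G a b * Y l b\<close> on the right,
  and summing the latter over \<open>a\<close> and \<open>b\<close> yields \<open>S k l\<close>. The
  transpose is what leaves \<open>l\<close> as the second index in both legs.\<close>

lemma (in complex_alg) coproduct_twisted_matrix:
  fixes X Y :: "(nat \<Rightarrow> 'a) mat" and G :: "complex mat" and N :: nat
  defines "S \<equiv> mat_prod (series_ring A) N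
      (mat_prod (series_ring A) N X (\<lambda>i j. const_series A (G i j))) (mat_transpose Y)"
  assumes D: "D \<in> alg_hom A (alg_tensor A A)"
    and X: "\<And>i j. i \<in> {1..N} \<Longrightarrow> j \<in> {1..N} \<Longrightarrow> X i j \<in> carrier (series_ring A)"
    and Y: "\<And>i j. i \<in> {1..N} \<Longrightarrow> j \<in> {1..N} \<Longrightarrow> Y i j \<in> carrier (series_ring A)"
    and DX: "\<And>i j. i \<in> {1..N} \<Longrightarrow> j \<in> {1..N} \<Longrightarrow> (\<lambda>r. D (X i j r)) =
      (\<Oplus>\<^bsub>series_ring (alg_tensor A A)\<^esub>k\<in>{1..N}. series_tensor A A (X i k) (X k j))"
    and DY: "\<And>i j. i \<in> {1..N} \<Longrightarrow> j \<in> {1..N} \<Longrightarrow> (\<lambda>r. D (Y i j r)) =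
      (\<Oplus>\<^bsub>series_ring (alg_tensor A A)\<^esub>k\<in>{1..N}. series_tensor A A (Y i k) (Y k j))"
    and ij: "i \<in> {1..N}" "j \<in> {1..N}"
  shows "(\<lambda>r. D (S i j r)) =
    (\<Oplus>\<^bsub>series_ring (alg_tensor A A)\<^esub>k\<in>{1..N}. \<Oplus>\<^bsub>series_ring (alg_tensor A A)\<^esub>l\<in>{1..N}.
       series_tensor A A (X i k \<otimes>\<^bsub>series_ring A\<^esub> Y j l) (S k l))"
proof -
  interpret P: alg_pair A A ..
  let ?R = "series_ring A" and ?RT = "series_ring (alg_tensor A A)" and ?I = "{1..N}"
  let ?st = "series_tensor A A" and ?G = "\<lambda>i j. const_series A (G i j)"
  interpret D: ring_hom_ring ?R ?RT "\<lambda>f r. D (f r)"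
    by (rule alg_hom_series[OF complex_alg_axioms P.T.complex_alg_axioms D])
  note st_closed = P.series_tensor_closed
  \<comment> \<open>The product of \<open>X\<close> with \<open>G\<close> is treated first: its
    coproduct again has matrix form, with \<open>X i k\<close> on the left and \<open>W k b\<close>
    on the right, so the second multiplication meets the constants only through
    \<open>W\<close>.\<close>
  define W where "W = mat_prod ?R N X ?G"
  have W: "W i j \<in> carrier ?R" if "i \<in> ?I" "j \<in> ?I" for i j
    unfolding W_def using that X const_series_closed by (intro mat_prod_series_closed) auto
  have S: "S i j = (\<Oplus>\<^bsub>?R\<^esub>b\<in>?I. W i b \<otimes>\<^bsub>?R\<^esub> Y j b)" for i j
    by (simp add: S_def W_def mat_prod_def mat_transpose_def)
  have DW: "(\<lambda>r. D (W i b r)) = (\<Oplus>\<^bsub>?RT\<^esub>k\<in>?I. ?st (X i k) (W k b))" if b: "b \<in> ?I" for b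
  proof -
    have "(\<lambda>r. D (W i b r)) = (\<Oplus>\<^bsub>?RT\<^esub>a\<in>?I. (\<lambda>r. D ((X i a \<otimes>\<^bsub>?R\<^esub> ?G a b) r)))"
      unfolding W_def mat_prod_def using ij b X const_series_closed
      by (subst D.hom_finsum) (auto simp: o_def)
    also have "\<dots> = (\<Oplus>\<^bsub>?RT\<^esub>a\<in>?I. \<Oplus>\<^bsub>?RT\<^esub>k\<in>?I. ?st (X i k) (X k a \<otimes>\<^bsub>?R\<^esub> ?G a b))"
    proof (rule P.ST.finsum_cong'[OF refl])
      fix a assume a: "a \<in> ?I"
      have "(\<lambda>r. D ((X i a \<otimes>\<^bsub>?R\<^esub> ?G a b) r)) =
          (\<lambda>r. D (X i a r)) \<otimes>\<^bsub>?RT\<^esub> const_series (alg_tensor A A) (G a b)"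
        using D.hom_mult[OF X[OF ij(1) a] const_series_closed]
        by (simp add: alg_hom_const_series[OF complex_alg_axioms P.T.complex_alg_axioms D])
      also have "\<dots> = (\<Oplus>\<^bsub>?RT\<^esub>k\<in>?I. ?st (X i k) (X k a) \<otimes>\<^bsub>?RT\<^esub> const_series (alg_tensor A A) (G a b))"
        unfolding DX[OF ij(1) a] using X ij a P.T.const_series_closed
        by (intro P.ST.finsum_ldistr) (auto intro!: st_closed)
      also have "\<dots> = (\<Oplus>\<^bsub>?RT\<^esub>k\<in>?I. ?st (X i k) (X k a \<otimes>\<^bsub>?R\<^esub> ?G a b))"
        using X ij a const_series_closed
        by (intro P.ST.finsum_cong' refl) (auto intro!: st_closed P.series_tensor_mult_const)
      finally show "(\<lambda>r. D ((X i a \<otimes>\<^bsub>?R\<^esub> ?G a b) r)) =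
          (\<Oplus>\<^bsub>?RT\<^esub>k\<in>?I. ?st (X i k) (X k a \<otimes>\<^bsub>?R\<^esub> ?G a b))" .
    qed (use X ij const_series_closed in \<open>auto intro!: st_closed P.ST.finsum_closed\<close>)
    \<comment> \<open>With \<open>a\<close> innermost, the left factor \<open>X i k\<close> is
      constant in the inner sum, which can then be gathered into \<open>W k b\<close>.\<close>
    also have "\<dots> = (\<Oplus>\<^bsub>?RT\<^esub>k\<in>?I. \<Oplus>\<^bsub>?RT\<^esub>a\<in>?I. ?st (X i k) (X k a \<otimes>\<^bsub>?R\<^esub> ?G a b))"
      using X ij const_series_closed by (intro P.ST.finsum_swap) (auto intro!: st_closed)
    also have "\<dots> = (\<Oplus>\<^bsub>?RT\<^esub>k\<in>?I. ?st (X i k) (W k b))"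
    proof (rule P.ST.finsum_cong'[OF refl])
      fix k assume k: "k \<in> ?I"
      show "(\<Oplus>\<^bsub>?RT\<^esub>a\<in>?I. ?st (X i k) (X k a \<otimes>\<^bsub>?R\<^esub> ?G a b)) = ?st (X i k) (W k b)"
        unfolding W_def mat_prod_def using X ij k const_series_closed
        by (intro P.series_tensor_finsum_right[symmetric]) auto
    qed (use X W ij b in \<open>auto intro!: st_closed\<close>)
    finally show ?thesis .
  qed
  have prod_closed: "X i k \<otimes>\<^bsub>?R\<^esub> Y j l \<in> carrier ?R" if "k \<in> ?I" "l \<in> ?I" for k l
    using that X Y ij by auto
  have WY_closed: "W k b \<otimes>\<^bsub>?R\<^esub> Y l b \<in> carrier ?R" if "k \<in> ?I" "l \<in> ?I" "b \<in> ?I" for k l b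
    using that W Y by auto
  have "(\<lambda>r. D (S i j r)) = (\<Oplus>\<^bsub>?RT\<^esub>b\<in>?I. (\<lambda>r. D ((W i b \<otimes>\<^bsub>?R\<^esub> Y j b) r)))"
    unfolding S using ij W Y by (subst D.hom_finsum) (auto simp: o_def)
  also have "\<dots> = (\<Oplus>\<^bsub>?RT\<^esub>b\<in>?I. \<Oplus>\<^bsub>?RT\<^esub>k\<in>?I. \<Oplus>\<^bsub>?RT\<^esub>l\<in>?I.
      ?st (X i k \<otimes>\<^bsub>?R\<^esub> Y j l) (W k b \<otimes>\<^bsub>?R\<^esub> Y l b))"
  proof (rule P.ST.finsum_cong'[OF refl])
    fix b assume b: "b \<in> ?I"
    let ?y = "\<Oplus>\<^bsub>?RT\<^esub>l\<in>?I. ?st (Y j l) (Y l b)"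
    have "(\<lambda>r. D ((W i b \<otimes>\<^bsub>?R\<^esub> Y j b) r)) = (\<Oplus>\<^bsub>?RT\<^esub>k\<in>?I. ?st (X i k) (W k b)) \<otimes>\<^bsub>?RT\<^esub> ?y"
      using D.hom_mult[OF W[OF ij(1) b] Y[OF ij(2) b]] by (simp add: DW[OF b] DY[OF ij(2) b])
    also have "\<dots> = (\<Oplus>\<^bsub>?RT\<^esub>k\<in>?I. ?st (X i k) (W k b) \<otimes>\<^bsub>?RT\<^esub> ?y)"
      using X W Y ij b by (intro P.ST.finsum_ldistr) (auto intro!: st_closed P.ST.finsum_closed)
    also have "\<dots> = (\<Oplus>\<^bsub>?RT\<^esub>k\<in>?I. \<Oplus>\<^bsub>?RT\<^esub>l\<in>?I. ?st (X i k \<otimes>\<^bsub>?R\<^esub> Y j l) (W k b \<otimes>\<^bsub>?R\<^esub> Y l b))"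
    proof (rule P.ST.finsum_cong'[OF refl])
      fix k assume k: "k \<in> ?I"
      have "?st (X i k) (W k b) \<otimes>\<^bsub>?RT\<^esub> ?y =
          (\<Oplus>\<^bsub>?RT\<^esub>l\<in>?I. ?st (X i k) (W k b) \<otimes>\<^bsub>?RT\<^esub> ?st (Y j l) (Y l b))"
        using X W Y ij b k by (intro P.ST.finsum_rdistr) (auto intro!: st_closed)
      also have "\<dots> = (\<Oplus>\<^bsub>?RT\<^esub>l\<in>?I. ?st (X i k \<otimes>\<^bsub>?R\<^esub> Y j l) (W k b \<otimes>\<^bsub>?R\<^esub> Y l b))"
        using X W Y ij b k prod_closed WY_closed
        by (intro P.ST.finsum_cong' refl Pi_I st_closed P.series_tensor_mult) auto
      finally show "?st (X i k) (W k b) \<otimes>\<^bsub>?RT\<^esub> ?y =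
          (\<Oplus>\<^bsub>?RT\<^esub>l\<in>?I. ?st (X i k \<otimes>\<^bsub>?R\<^esub> Y j l) (W k b \<otimes>\<^bsub>?R\<^esub> Y l b))" .
    qed (use prod_closed WY_closed b in \<open>blast intro!: st_closed P.ST.finsum_closed\<close>)
    finally show "(\<lambda>r. D ((W i b \<otimes>\<^bsub>?R\<^esub> Y j b) r)) =
        (\<Oplus>\<^bsub>?RT\<^esub>k\<in>?I. \<Oplus>\<^bsub>?RT\<^esub>l\<in>?I. ?st (X i k \<otimes>\<^bsub>?R\<^esub> Y j l) (W k b \<otimes>\<^bsub>?R\<^esub> Y l b))" .
  qed (use prod_closed WY_closed in \<open>blast intro!: st_closed P.ST.finsum_closed\<close>)
  \<comment> \<open>The sum over \<open>b\<close> now moves inward, past \<open>k\<close> here and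
    past \<open>l\<close> in the next step. The left leg does not involve \<open>b\<close>, so the
    innermost sum closes up to \<open>S k l\<close>.\<close>
  also have "\<dots> = (\<Oplus>\<^bsub>?RT\<^esub>k\<in>?I. \<Oplus>\<^bsub>?RT\<^esub>b\<in>?I. \<Oplus>\<^bsub>?RT\<^esub>l\<in>?I.
      ?st (X i k \<otimes>\<^bsub>?R\<^esub> Y j l) (W k b \<otimes>\<^bsub>?R\<^esub> Y l b))"
    using prod_closed WY_closed
    by (intro P.ST.finsum_swap) (blast intro!: st_closed P.ST.finsum_closed finite_atLeastAtMost)+
  also have "\<dots> = (\<Oplus>\<^bsub>?RT\<^esub>k\<in>?I. \<Oplus>\<^bsub>?RT\<^esub>l\<in>?I. ?st (X i k \<otimes>\<^bsub>?R\<^esub> Y j l) (S k l))"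
  proof (rule P.ST.finsum_cong'[OF refl])
    fix k assume k: "k \<in> ?I"
    have "(\<Oplus>\<^bsub>?RT\<^esub>b\<in>?I. \<Oplus>\<^bsub>?RT\<^esub>l\<in>?I. ?st (X i k \<otimes>\<^bsub>?R\<^esub> Y j l) (W k b \<otimes>\<^bsub>?R\<^esub> Y l b)) =
        (\<Oplus>\<^bsub>?RT\<^esub>l\<in>?I. \<Oplus>\<^bsub>?RT\<^esub>b\<in>?I. ?st (X i k \<otimes>\<^bsub>?R\<^esub> Y j l) (W k b \<otimes>\<^bsub>?R\<^esub> Y l b))"
      using prod_closed WY_closed k
      by (intro P.ST.finsum_swap) (blast intro!: st_closed finite_atLeastAtMost)+
    also have "\<dots> = (\<Oplus>\<^bsub>?RT\<^esub>l\<in>?I. ?st (X i k \<otimes>\<^bsub>?R\<^esub> Y j l) (S k l))"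
      unfolding S using prod_closed WY_closed k
      by (intro P.ST.finsum_cong'[OF refl] Pi_I st_closed P.SA.finsum_closed
          P.series_tensor_finsum_right[symmetric]) (blast intro: finite_atLeastAtMost)+
    finally show "(\<Oplus>\<^bsub>?RT\<^esub>b\<in>?I. \<Oplus>\<^bsub>?RT\<^esub>l\<in>?I. ?st (X i k \<otimes>\<^bsub>?R\<^esub> Y j l) (W k b \<otimes>\<^bsub>?R\<^esub> Y l b)) =
        (\<Oplus>\<^bsub>?RT\<^esub>l\<in>?I. ?st (X i k \<otimes>\<^bsub>?R\<^esub> Y j l) (S k l))" .
  next
    show "(\<lambda>k. \<Oplus>\<^bsub>?RT\<^esub>l\<in>?I. ?st (X i k \<otimes>\<^bsub>?R\<^esub> Y j l) (S k l)) \<in> ?I \<rightarrow> carrier ?RT"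
      unfolding S using prod_closed WY_closed
      by (intro Pi_I P.ST.finsum_closed st_closed P.SA.finsum_closed) blast+
  qed
  finally show ?thesis .
qed

lemma is_subalg_vimage:
  assumes "complex_alg A" "complex_alg B" "h \<in> alg_hom A B" "is_subalg Z B"
  shows "is_subalg {x \<in> carrier A. h x \<in> Z} A"
proof -
  interpret A: complex_alg A by fact
  interpret B: complex_alg B by fact
  have h: "h \<in> ring_hom A B"
    and smult: "\<And>c x. x \<in> carrier A \<Longrightarrow> h (c \<odot>\<^bsub>A\<^esub> x) = c \<odot>\<^bsub>B\<^esub> h x"
    using assms(3) by (simp_all add: alg_hom_def)
  interpret h: ring_hom_ring A B h
    by (rule ring_hom_ringI2[OF A.ring_axioms B.ring_axioms h])
  note Z = is_subalgD[OF assms(4)]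
  have "\<ominus>\<^bsub>B\<^esub> x \<in> Z" if "x \<in> Z" for x
    using assms(4) subringE(5)[of Z B x] that by (simp add: is_subalg_def)
  then show ?thesis
    using Z by (intro A.is_subalgI) (auto simp: smult)
qed

section \<open>The symplectic twisted q-Yangian\<close>

lemma odd_index_Suc: "i \<in> {1..2 * n} \<Longrightarrow> odd i \<Longrightarrow> Suc i \<in> {1..2 * n}" for n :: nat
  by (simp, presburger)

lemma Gmat_eq_0:
  assumes "\<not> (odd i \<and> j = i + 1)" "\<not> (odd j \<and> i = j + 1)"
  shows "Gmat n q i j = 0"
proof -
  have "mat_unit (2 * k - 1) (2 * k) i j = (0::complex)"
    "mat_unit (2 * k) (2 * k - 1) i j = (0::complex)" if "k \<in> {1..n}" for k
    using that assms by (auto simp: mat_unit_def)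
  then show ?thesis
    by (simp add: Gmat_def)
qed

lemma Gmat_upper:
  assumes "i \<in> {1..2 * n}" "odd i"
  shows "Gmat n q i (Suc i) = q"
proof -
  from assms(2) obtain m where m: "i = 2 * m + 1"
    by (elim oddE)
  have "(\<Sum>k\<in>{1..n}. mat_unit (2 * k - 1) (2 * k) i (Suc i)) = (\<Sum>k\<in>{1..n}. if k = Suc m then 1 else (0::complex))"
    by (intro sum.cong refl) (auto simp: mat_unit_def m)
  moreover have "(\<Sum>k\<in>{1..n}. mat_unit (2 * k) (2 * k - 1) i (Suc i)) = (0::complex)"
    by (intro sum.neutral) (auto simp: mat_unit_def m)
  ultimately show ?thesis
    using assms(1) by (simp add: Gmat_def m)
qed

section \<open>Constant terms of S(u) and their invertibility\<close>

lemma s_ser_closed: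
  assumes "i \<in> {1..2 * n}" "j \<in> {1..2 * n}"
  shows "s_ser n q i j \<in> carrier (series_ring (Uq (2 * n) q))"
proof -
  interpret U: complex_alg "Uq (2 * n) q"
    by (rule complex_alg_Uq)
  show ?thesis
    unfolding s_ser_def Let_def mat_transpose_def using assms
    by (intro U.mat_prod_series_closed t_ser_closed tbar_ser_closed U.const_series_closed)
qed

text \<open>The constant term is a sum over \<open>a\<close>, \<open>b\<close> of
  \<open>Gmat n q a b\<close> times \<open>t_ser\<close> at \<open>(i, a)\<close> times
  \<open>tbar_ser\<close> at \<open>(Suc i, b)\<close>. Triangularity forces
  \<open>a \<le> i\<close> and \<open>b \<ge> Suc i\<close>. The nonzero entries of G sit at the
  pairs \<open>{2 k - 1, 2 k}\<close>, and the only one left in that corner is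
  \<open>(i, Suc i)\<close>, with value \<open>q\<close>.\<close>

lemma s_ser_prime_0:
  assumes i: "i \<in> {1..2 * n}" "odd i"
  shows "s_ser n q i (Suc i) 0 =
    q \<odot>\<^bsub>Uq (2 * n) q\<^esub> (t_ser (2 * n) q i i 0 \<otimes>\<^bsub>Uq (2 * n) q\<^esub> tbar_ser (2 * n) q (Suc i) (Suc i) 0)"
proof -
  let ?U = "Uq (2 * n) q" and ?I = "{1..2 * n}"
  let ?t = "\<lambda>i j. t_ser (2 * n) q i j 0" and ?tb = "\<lambda>i j. tbar_ser (2 * n) q i j 0"
  interpret U: complex_alg ?U
    by (rule complex_alg_Uq)
  interpret S: ring "series_ring ?U"
    by (rule U.ring_series_ring)
  have i': "Suc i \<in> ?I"
    using i by (rule odd_index_Suc)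
  have t: "?t a b \<in> carrier ?U" and tb: "?tb a b \<in> carrier ?U" if "a \<in> ?I" "b \<in> ?I" for a b
    using t_ser_closed[OF that] tbar_ser_closed[OF that] by (simp_all add: series_ring_sel)
  let ?x = "q \<odot>\<^bsub>?U\<^esub> (?t i i \<otimes>\<^bsub>?U\<^esub> ?tb (Suc i) (Suc i))"
  let ?W = "\<lambda>b. \<Oplus>\<^bsub>series_ring ?U\<^esub>a\<in>?I. t_ser (2 * n) q i a \<otimes>\<^bsub>series_ring ?U\<^esub> const_series ?U (Gmat n q a b)"
  have W: "?W b \<in> carrier (series_ring ?U)" if "b \<in> ?I" for b
    using i that by (intro S.finsum_closed) (auto intro!: t_ser_closed U.const_series_closed)
  have W0: "?W b 0 = (\<Oplus>\<^bsub>?U\<^esub>a\<in>?I. Gmat n q a b \<odot>\<^bsub>?U\<^esub> ?t i a)" if "b \<in> ?I" for b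
  proof -
    have ti: "t_ser (2 * n) q i a \<in> carrier (series_ring ?U)" if "a \<in> ?I" for a
      using i(1) that by (rule t_ser_closed)
    have "?W b 0 = (\<Oplus>\<^bsub>?U\<^esub>a\<in>?I. (t_ser (2 * n) q i a \<otimes>\<^bsub>series_ring ?U\<^esub> const_series ?U (Gmat n q a b)) 0)"
      using ti by (intro U.finsum_series_nth) (auto intro!: U.const_series_closed)
    also have "\<dots> = (\<Oplus>\<^bsub>?U\<^esub>a\<in>?I. Gmat n q a b \<odot>\<^bsub>?U\<^esub> ?t i a)"
      using ti t i(1) by (intro U.finsum_cong'[OF refl]) (auto simp: U.series_mult_const_right)
    finally show ?thesis .
  qed
  have "s_ser n q i (Suc i) 0 = (\<Oplus>\<^bsub>?U\<^esub>b\<in>?I. (?W b \<otimes>\<^bsub>series_ring ?U\<^esub> tbar_ser (2 * n) q (Suc i) b) 0)"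
    unfolding s_ser_def Let_def mat_prod_def mat_transpose_def
    using W tbar_ser_closed[OF i'] by (intro U.finsum_series_nth) auto
  also have "\<dots> = (\<Oplus>\<^bsub>?U\<^esub>b\<in>?I. if Suc i = b then ?x else \<zero>\<^bsub>?U\<^esub>)"
  proof (rule U.finsum_cong'[OF refl])
    fix b assume b: "b \<in> ?I"
    have "?W b 0 \<in> carrier ?U"
      using W[OF b] by (simp add: series_ring_sel)
    then have 1: "(?W b \<otimes>\<^bsub>series_ring ?U\<^esub> tbar_ser (2 * n) q (Suc i) b) 0 = ?W b 0 \<otimes>\<^bsub>?U\<^esub> ?tb (Suc i) b"
      using tb[OF i' b] by (simp add: series_ring_sel(2))
    show "(?W b \<otimes>\<^bsub>series_ring ?U\<^esub> tbar_ser (2 * n) q (Suc i) b) 0 = (if Suc i = b then ?x else \<zero>\<^bsub>?U\<^esub>)"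
    proof (cases "b < Suc i")
      case True
      then show ?thesis
        using tbar_ser_lower_zero[OF b i' True, of q] \<open>?W b 0 \<in> carrier ?U\<close> unfolding 1 by simp
    next
      case False
      have "?W b 0 = (\<Oplus>\<^bsub>?U\<^esub>a\<in>?I. if i = a then Gmat n q i b \<odot>\<^bsub>?U\<^esub> ?t i i else \<zero>\<^bsub>?U\<^esub>)"
        unfolding W0[OF b]
      proof (rule U.finsum_cong'[OF refl])
        fix a assume a: "a \<in> ?I"
        \<comment> \<open>A nonzero entry above the diagonal has \<open>b = a + 1\<close>, which is
          incompatible with \<open>a < i < b\<close>.\<close>
        have "Gmat n q a b = 0" if "a < i"
          using that False i(2) by (intro Gmat_eq_0) auto
        moreover have "?t i a = \<zero>\<^bsub>?U\<^esub>" if "i < a"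
          using that i a by (intro t_ser_upper_zero) auto
        ultimately show "Gmat n q a b \<odot>\<^bsub>?U\<^esub> ?t i a = (if i = a then Gmat n q i b \<odot>\<^bsub>?U\<^esub> ?t i i else \<zero>\<^bsub>?U\<^esub>)"
          using t[OF i(1) a] by (cases a i rule: linorder_cases) (auto simp: U.smult_zero_left)
      qed (use i t in auto)
      also have "\<dots> = Gmat n q i b \<odot>\<^bsub>?U\<^esub> ?t i i"
        using i t U.finsum_singleton[of i ?I "\<lambda>a. Gmat n q i b \<odot>\<^bsub>?U\<^esub> ?t i i"] by simp
      finally have 2: "?W b 0 = Gmat n q i b \<odot>\<^bsub>?U\<^esub> ?t i i" .
      show ?thesis
      proof (cases "b = Suc i")
        case True
        then show ?thesis
          unfolding 1 2 using i i' t tb by (simp add: Gmat_upper U.smult_mult_left)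
      next
        case False
        then have "Gmat n q i b = 0"
          using \<open>\<not> b < Suc i\<close> by (intro Gmat_eq_0) auto
        then show ?thesis
          unfolding 1 2 using i i' t tb b False by (simp add: U.smult_zero_left)
      qed
    qed
  qed (use i i' t tb in auto)
  also have "\<dots> = ?x"
    using i i' t tb U.finsum_singleton[of "Suc i" ?I "\<lambda>_. ?x"] by simp
  finally show ?thesis .
qed

text \<open>Diagonal constant terms of \<open>t_ser\<close> and \<open>tbar_ser\<close> with equal
  index are mutually inverse, so each is a unit, and so is a product with different indices. The
  second claim provides the factor for the first leg when the coproduct of an inverse generator is
  computed.\<close>

lemma s_ser_prime_0_inverse:
  assumes i: "i \<in> {1..2 * n}" "odd i" and "q \<noteq> 0"
  shows "s_ser n q i (Suc i) 0 \<in> Units (Uq (2 * n) q)"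
    and "\<exists>y\<in>carrier (Uq (2 * n) q).
      t_ser (2 * n) q i i 0 \<otimes>\<^bsub>Uq (2 * n) q\<^esub> tbar_ser (2 * n) q (Suc i) (Suc i) 0 \<otimes>\<^bsub>Uq (2 * n) q\<^esub> y
        = \<one>\<^bsub>Uq (2 * n) q\<^esub>"
proof -
  let ?U = "Uq (2 * n) q" and ?I = "{1..2 * n}"
  let ?t = "\<lambda>i. t_ser (2 * n) q i i 0" and ?tb = "\<lambda>i. tbar_ser (2 * n) q i i 0"
  interpret U: complex_alg ?U
    by (rule complex_alg_Uq)
  have i': "Suc i \<in> ?I"
    using i by (rule odd_index_Suc)
  have carr: "?t a \<in> carrier ?U" "?tb a \<in> carrier ?U" if "a \<in> ?I" for a
    using t_ser_closed[OF that that] tbar_ser_closed[OF that that] by (simp_all add: series_ring_sel)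
  have unit: "?t a \<in> Units ?U" "?tb a \<in> Units ?U" if "a \<in> ?I" for a
    using carr[OF that] t_ser_tbar_ser_inverse[OF that, of q] unfolding Units_def by blast+
  have x: "?t i \<otimes>\<^bsub>?U\<^esub> ?tb (Suc i) \<in> Units ?U"
    by (intro U.Units_m_closed unit i i')
  then show "\<exists>y\<in>carrier ?U. ?t i \<otimes>\<^bsub>?U\<^esub> ?tb (Suc i) \<otimes>\<^bsub>?U\<^esub> y = \<one>\<^bsub>?U\<^esub>"
    using U.Units_r_inv U.Units_inv_closed by blast
  \<comment> \<open>Turning the scalar into an element of the algebra exhibits the constant term as
    a product of units; this is where \<open>q \<noteq> 0\<close> enters.\<close>
  have "q \<odot>\<^bsub>?U\<^esub> \<one>\<^bsub>?U\<^esub> \<in> Units ?U"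
    using assms(3) U.smult_assoc[of "\<one>\<^bsub>?U\<^esub>" q "inverse q"] U.smult_assoc[of "\<one>\<^bsub>?U\<^esub>" "inverse q" q]
    by (auto simp: Units_def U.smult_mult_left U.smult_mult_right
        intro!: bexI[of _ "inverse q \<odot>\<^bsub>?U\<^esub> \<one>\<^bsub>?U\<^esub>"])
  then have "q \<odot>\<^bsub>?U\<^esub> \<one>\<^bsub>?U\<^esub> \<otimes>\<^bsub>?U\<^esub> (?t i \<otimes>\<^bsub>?U\<^esub> ?tb (Suc i)) \<in> Units ?U"
    using x by (rule U.Units_m_closed)
  moreover have "?t i \<otimes>\<^bsub>?U\<^esub> ?tb (Suc i) \<in> carrier ?U"
    using carr i i' by simp
  ultimately show "s_ser n q i (Suc i) 0 \<in> Units ?U"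
    unfolding s_ser_prime_0[OF i] by (simp add: U.smult_mult_left)
qed

section \<open>Generators of the twisted q-Yangian and the coideal property\<close>

definition Ytw_gens :: "nat \<Rightarrow> complex \<Rightarrow> (gen list \<Rightarrow> complex) set set" where
  "Ytw_gens n q = {s_ser n q i j r | i j r. i \<in> {1..2 * n} \<and> j \<in> {1..2 * n}} \<union>
      {inv\<^bsub>Uq (2 * n) q\<^esub> (s_ser n q i (idx_prime i) 0) | i. i \<in> {1..2 * n} \<and> odd i}"

lemma Ytw_sp_eq: "Ytw_sp n q = subalg_gen (Uq (2 * n) q) (Ytw_gens n q)"
  unfolding Ytw_sp_def Ytw_gens_def ..

text \<open>\<open>inv\<close> is a definite description, meaningful only on units, so the inverse
  generators lie in the carrier thanks to \<open>s_ser_prime_0_inverse\<close>.\<close>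

lemma Ytw_gens_closed:
  assumes "q \<noteq> 0"
  shows "Ytw_gens n q \<subseteq> carrier (Uq (2 * n) q)"
proof -
  interpret U: complex_alg "Uq (2 * n) q"
    by (rule complex_alg_Uq)
  have "s_ser n q i j r \<in> carrier (Uq (2 * n) q)" if "i \<in> {1..2 * n}" "j \<in> {1..2 * n}" for i j r
    using s_ser_closed[OF that] by (simp add: series_ring_sel)
  moreover have "inv\<^bsub>Uq (2 * n) q\<^esub> (s_ser n q i (idx_prime i) 0) \<in> carrier (Uq (2 * n) q)"
    if "i \<in> {1..2 * n}" "odd i" for i
    using s_ser_prime_0_inverse(1)[OF that assms] that by (simp add: idx_prime_def)
  ultimately show ?thesis
    unfolding Ytw_gens_def by blast
qed

text \<open>For \<open>k \<noteq> i\<close> the positions \<open>(i, k)\<close> and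
  \<open>(k, i)\<close> lie on opposite sides of the diagonal, so one of the two tensor factors
  vanishes at order 0.\<close>

lemma coproduct_t_tbar_diagonal:
  assumes "is_coproduct N q \<Delta>" "i \<in> {1..N}"
  shows "\<Delta> (t_ser N q i i 0) = pure_tensor (Uq N q) (Uq N q) (t_ser N q i i 0) (t_ser N q i i 0)"
    and "\<Delta> (tbar_ser N q i i 0) = pure_tensor (Uq N q) (Uq N q) (tbar_ser N q i i 0) (tbar_ser N q i i 0)"
proof -
  let ?U = "Uq N q" and ?I = "{1..N}"
  interpret U: complex_alg ?U
    by (rule complex_alg_Uq)
  interpret P: alg_pair ?U ?U ..
  \<comment> \<open>The disjunction in \<open>zero\<close> does not say which triangle vanishes, so
    one argument serves the lower triangular T and the upper triangular matrix of the
    \<open>tbar_ser\<close>.\<close>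
  have diag: "(\<Oplus>\<^bsub>series_ring P.T\<^esub>k\<in>?I. series_tensor ?U ?U (X i k) (X k i)) 0 = P.pure (X i i 0) (X i i 0)"
    if X: "\<And>i j. i \<in> ?I \<Longrightarrow> j \<in> ?I \<Longrightarrow> X i j \<in> carrier (series_ring ?U)"
      and zero: "\<And>k. k \<in> ?I \<Longrightarrow> k \<noteq> i \<Longrightarrow> X i k 0 = \<zero>\<^bsub>?U\<^esub> \<or> X k i 0 = \<zero>\<^bsub>?U\<^esub>"
    for X :: "(nat \<Rightarrow> (gen list \<Rightarrow> complex) set) mat"
  proof -
    have carr: "X a b 0 \<in> carrier ?U" if "a \<in> ?I" "b \<in> ?I" for a b
      using X[OF that] by (simp add: series_ring_sel)
    have "(\<Oplus>\<^bsub>series_ring P.T\<^esub>k\<in>?I. series_tensor ?U ?U (X i k) (X k i)) 0 =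
        (\<Oplus>\<^bsub>P.T\<^esub>k\<in>?I. series_tensor ?U ?U (X i k) (X k i) 0)"
      using X assms(2) by (intro P.T.finsum_series_nth) (auto intro!: P.series_tensor_closed)
    also have "\<dots> = (\<Oplus>\<^bsub>P.T\<^esub>k\<in>?I. if i = k then P.pure (X i i 0) (X i i 0) else \<zero>\<^bsub>P.T\<^esub>)"
    proof (rule P.T.finsum_cong'[OF refl])
      fix k assume k: "k \<in> ?I"
      have "series_tensor ?U ?U (X i k) (X k i) 0 = P.pure (X i k 0) (X k i 0)"
        using carr k assms(2) by (simp add: series_tensor_def)
      then show "series_tensor ?U ?U (X i k) (X k i) 0 =
          (if i = k then P.pure (X i i 0) (X i i 0) else \<zero>\<^bsub>P.T\<^esub>)"
        using zero[OF k] carr k assms(2) by (auto simp: P.pure_zero_left P.pure_zero_right)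
    qed (use carr assms(2) in auto)
    also have "\<dots> = P.pure (X i i 0) (X i i 0)"
      using carr assms(2) P.T.finsum_singleton[of i ?I "\<lambda>_. P.pure (X i i 0) (X i i 0)"] by simp
    finally show ?thesis .
  qed
  have "(\<lambda>r. \<Delta> (t_ser N q i i r)) =
      (\<Oplus>\<^bsub>series_ring P.T\<^esub>k\<in>?I. series_tensor ?U ?U (t_ser N q i k) (t_ser N q k i))"
    and "(\<lambda>r. \<Delta> (tbar_ser N q i i r)) =
      (\<Oplus>\<^bsub>series_ring P.T\<^esub>k\<in>?I. series_tensor ?U ?U (tbar_ser N q i k) (tbar_ser N q k i))"
    using assms by (simp_all add: is_coproduct_def Let_def)
  note D = this[THEN fun_cong, of 0]
  have "t_ser N q i k 0 = \<zero>\<^bsub>?U\<^esub> \<or> t_ser N q k i 0 = \<zero>\<^bsub>?U\<^esub>"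
    "tbar_ser N q i k 0 = \<zero>\<^bsub>?U\<^esub> \<or> tbar_ser N q k i 0 = \<zero>\<^bsub>?U\<^esub>" if "k \<in> ?I" "k \<noteq> i" for k
    using that assms(2) t_ser_upper_zero[of i N k q] t_ser_upper_zero[of k N i q]
      tbar_ser_lower_zero[of i N k q] tbar_ser_lower_zero[of k N i q]
    by (cases "i < k"; simp)+
  note off_diag = this
  show "\<Delta> (t_ser N q i i 0) = P.pure (t_ser N q i i 0) (t_ser N q i i 0)"
    unfolding D(1) by (rule diag[of "t_ser N q", OF t_ser_closed off_diag(1)])
  show "\<Delta> (tbar_ser N q i i 0) = P.pure (tbar_ser N q i i 0) (tbar_ser N q i i 0)"
    unfolding D(2) by (rule diag[of "tbar_ser N q", OF tbar_ser_closed off_diag(2)])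
qed

theorem proposition3p13:
  fixes q :: complex and n :: nat
    and \<Delta> :: "(gen list \<Rightarrow> complex) set \<Rightarrow>
               ((gen list \<Rightarrow> complex) set \<times> (gen list \<Rightarrow> complex) set \<Rightarrow> complex) set"
  assumes "q \<noteq> 0"
    and "\<And>m::nat. m > 0 \<Longrightarrow> q ^ m \<noteq> 1"
    and "is_coproduct (2 * n) q \<Delta>"
  shows "\<Delta> ` Ytw_sp n q
           \<subseteq> sub_tensor (Uq (2 * n) q) (Uq (2 * n) q) (carrier (Uq (2 * n) q)) (Ytw_sp n q)
       \<and> (\<forall>i\<in>{1..2 * n}. \<forall>j\<in>{1..2 * n}.
            (\<lambda>r. \<Delta> (s_ser n q i j r)) =
              (\<Oplus>\<^bsub>series_ring (alg_tensor (Uq (2 * n) q) (Uq (2 * n) q))\<^esub>k\<in>{1..2 * n}.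
               \<Oplus>\<^bsub>series_ring (alg_tensor (Uq (2 * n) q) (Uq (2 * n) q))\<^esub>l\<in>{1..2 * n}.
                 series_tensor (Uq (2 * n) q) (Uq (2 * n) q)
                   (t_ser (2 * n) q i k
                      \<otimes>\<^bsub>series_ring (Uq (2 * n) q)\<^esub> tbar_ser (2 * n) q j l)
                   (s_ser n q k l)))"
proof -
  let ?U = "Uq (2 * n) q" and ?I = "{1..2 * n}"
  let ?t = "t_ser (2 * n) q" and ?tb = "tbar_ser (2 * n) q"
  interpret U: complex_alg ?U
    by (rule complex_alg_Uq)
  interpret P: alg_pair ?U ?U ..
  have hom: "\<Delta> \<in> alg_hom ?U P.T"
    using assms(3) by (simp add: is_coproduct_def Let_def)
  interpret D: ring_hom_ring ?U P.T \<Delta>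
    using hom by (intro ring_hom_ringI2 U.ring_axioms P.T.ring_axioms) (simp add: alg_hom_def)
  have coproduct: "(\<lambda>r. \<Delta> (s_ser n q i j r)) =
      (\<Oplus>\<^bsub>series_ring P.T\<^esub>k\<in>?I. \<Oplus>\<^bsub>series_ring P.T\<^esub>l\<in>?I.
         series_tensor ?U ?U (?t i k \<otimes>\<^bsub>series_ring ?U\<^esub> ?tb j l) (s_ser n q k l))"
    if "i \<in> ?I" "j \<in> ?I" for i j
    unfolding s_ser_def Let_def
  proof (rule U.coproduct_twisted_matrix[OF hom t_ser_closed tbar_ser_closed _ _ that])
    fix i j assume "i \<in> ?I" "j \<in> ?I"
    then show "(\<lambda>r. \<Delta> (?t i j r)) = (\<Oplus>\<^bsub>series_ring P.T\<^esub>k\<in>?I. series_tensor ?U ?U (?t i k) (?t k j))"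
      "(\<lambda>r. \<Delta> (?tb i j r)) = (\<Oplus>\<^bsub>series_ring P.T\<^esub>k\<in>?I. series_tensor ?U ?U (?tb i k) (?tb k j))"
      using assms(3) unfolding is_coproduct_def Let_def by blast+
  qed
  let ?Y = "Ytw_sp n q"
  let ?C = "sub_tensor ?U ?U (carrier ?U) ?Y"
  have Y: "is_subalg ?Y ?U"
    unfolding Ytw_sp_eq by (rule U.subalg_gen_is_subalg[OF Ytw_gens_closed[OF assms(1)]])
  have gens: "Ytw_gens n q \<subseteq> ?Y"
    unfolding Ytw_sp_eq by (rule U.subalg_gen_superset)
  have s_in_Y: "s_ser n q i j r \<in> ?Y" if "i \<in> ?I" "j \<in> ?I" for i j r
    by (rule subsetD[OF gens]) (use that in \<open>unfold Ytw_gens_def, blast\<close>)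
  have C: "is_subalg ?C P.T"
    by (rule P.is_subalg_sub_tensor[OF U.is_subalg_carrier Y])
  have C_sum: "(\<Oplus>\<^bsub>P.T\<^esub>k\<in>I. f k) \<in> ?C" if "finite I" "\<And>k. k \<in> I \<Longrightarrow> f k \<in> ?C"
    for I :: "nat set" and f
    using that is_subalgD[OF C] P.zero_in_sub_tensor by (intro P.T.finsum_mem) auto
  have pure_in_C: "P.pure a b \<in> ?C" if "a \<in> carrier ?U" "b \<in> ?Y" for a b
    using that is_subalgD(1)[OF Y] by (intro P.pure_in_sub_tensor) auto
  \<comment> \<open>In each coefficient of the formula the right legs are coefficients of some
    \<open>s_ser n q k l\<close>, hence generators; the left legs may be anything in the
    carrier.\<close>
  have s_mem: "\<Delta> (s_ser n q i j r) \<in> ?C" if ij: "i \<in> ?I" "j \<in> ?I" for i j r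
  proof -
    let ?f = "\<lambda>k l. ?t i k \<otimes>\<^bsub>series_ring ?U\<^esub> ?tb j l"
    have f: "?f k l \<in> carrier (series_ring ?U)" if "k \<in> ?I" "l \<in> ?I" for k l
      using that ij t_ser_closed tbar_ser_closed by (intro P.SA.m_closed)
    have st: "series_tensor ?U ?U (?f k l) (s_ser n q k l) \<in> carrier (series_ring P.T)"
      if "k \<in> ?I" "l \<in> ?I" for k l
      using that f s_ser_closed by (intro P.series_tensor_closed)
    have "\<Delta> (s_ser n q i j r) =
        (\<Oplus>\<^bsub>series_ring P.T\<^esub>k\<in>?I. \<Oplus>\<^bsub>series_ring P.T\<^esub>l\<in>?I. series_tensor ?U ?U (?f k l) (s_ser n q k l)) r"
      using fun_cong[OF coproduct[OF ij], of r] .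
    also have "\<dots> = (\<Oplus>\<^bsub>P.T\<^esub>k\<in>?I. (\<Oplus>\<^bsub>series_ring P.T\<^esub>l\<in>?I. series_tensor ?U ?U (?f k l) (s_ser n q k l)) r)"
      using st by (intro P.T.finsum_series_nth P.ST.finsum_closed) auto
    also have "\<dots> \<in> ?C"
    proof (rule C_sum)
      fix k assume k: "k \<in> ?I"
      have "(\<Oplus>\<^bsub>series_ring P.T\<^esub>l\<in>?I. series_tensor ?U ?U (?f k l) (s_ser n q k l)) r =
          (\<Oplus>\<^bsub>P.T\<^esub>l\<in>?I. series_tensor ?U ?U (?f k l) (s_ser n q k l) r)"
        using st k by (intro P.T.finsum_series_nth) auto
      also have "\<dots> \<in> ?C"
      proof (rule C_sum)
        fix l assume l: "l \<in> ?I"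
        show "series_tensor ?U ?U (?f k l) (s_ser n q k l) r \<in> ?C"
          unfolding series_tensor_def
        proof (rule C_sum)
          fix a
          show "P.pure (?f k l a) (s_ser n q k l (r - a)) \<in> ?C"
            using f[OF k l] s_in_Y[OF k l] by (intro pure_in_C) (simp_all only: series_ring_sel(1) mem_Collect_eq)
        qed simp
      qed simp
      finally show "(\<Oplus>\<^bsub>series_ring P.T\<^esub>l\<in>?I. series_tensor ?U ?U (?f k l) (s_ser n q k l)) r \<in> ?C" .
    qed simp
    finally show ?thesis .
  qed
  have inv_mem: "\<Delta> (inv\<^bsub>?U\<^esub> (s_ser n q i (idx_prime i) 0)) \<in> ?C" if i: "i \<in> ?I" "odd i" for i
  proof -
    have i': "Suc i \<in> ?I"
      using i by (rule odd_index_Suc)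
    let ?s = "s_ser n q i (Suc i) 0"
    let ?x = "?t i i 0 \<otimes>\<^bsub>?U\<^esub> ?tb (Suc i) (Suc i) 0"
    have t: "?t i i 0 \<in> carrier ?U" "?tb (Suc i) (Suc i) 0 \<in> carrier ?U"
      using t_ser_closed[OF i(1) i(1)] tbar_ser_closed[OF i' i'] by (simp_all add: series_ring_sel)
    have s: "?s \<in> Units ?U"
      by (rule s_ser_prime_0_inverse(1)[OF i assms(1)])
    obtain y where y: "y \<in> carrier ?U" "?x \<otimes>\<^bsub>?U\<^esub> y = \<one>\<^bsub>?U\<^esub>"
      using s_ser_prime_0_inverse(2)[OF i assms(1)] by blast
    have "\<Delta> ?s = q \<odot>\<^bsub>P.T\<^esub> \<Delta> ?x"
      unfolding s_ser_prime_0[OF i] using hom t by (simp add: alg_hom_def)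
    also have "\<Delta> ?x = P.pure ?x ?x"
      using t coproduct_t_tbar_diagonal(1)[OF assms(3) i(1)] coproduct_t_tbar_diagonal(2)[OF assms(3) i']
      by (simp add: P.pure_mult)
    \<comment> \<open>The scalar goes to the right leg, so that \<open>?s\<close>, whose inverse is
      a generator, stands there.\<close>
    also have "q \<odot>\<^bsub>P.T\<^esub> P.pure ?x ?x = P.pure ?x ?s"
      unfolding s_ser_prime_0[OF i] using t by (simp add: P.pure_smult_right)
    finally have Ds: "\<Delta> ?s = P.pure ?x ?s" .
    \<comment> \<open>\<open>P.pure y (inv ?s)\<close> is a right inverse of
      \<open>\<Delta> ?s\<close>, and \<open>\<Delta> (inv ?s)\<close> is a left inverse because
      \<open>\<Delta>\<close> is a homomorphism. The two agree by \<open>inv_unique\<close>, which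
      is why a right inverse \<open>y\<close> of \<open>?x\<close> is enough.\<close>
    have "\<Delta> ?s \<otimes>\<^bsub>P.T\<^esub> P.pure y (inv\<^bsub>?U\<^esub> ?s) = \<one>\<^bsub>P.T\<^esub>"
      unfolding Ds using t y s by (simp add: P.pure_mult U.Units_closed P.one_tensor)
    moreover have "\<Delta> (inv\<^bsub>?U\<^esub> ?s) \<otimes>\<^bsub>P.T\<^esub> \<Delta> ?s = \<one>\<^bsub>P.T\<^esub>"
      using s D.hom_mult[of "inv\<^bsub>?U\<^esub> ?s" ?s] by (simp add: U.Units_closed)
    ultimately have "\<Delta> (inv\<^bsub>?U\<^esub> ?s) = P.pure y (inv\<^bsub>?U\<^esub> ?s)"
      using s y by (intro P.T.inv_unique[of "\<Delta> (inv\<^bsub>?U\<^esub> ?s)" "\<Delta> ?s"]) (auto simp: U.Units_closed)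
    moreover have "inv\<^bsub>?U\<^esub> ?s \<in> ?Y"
      by (rule subsetD[OF gens]) (use i in \<open>auto simp: Ytw_gens_def idx_prime_def\<close>)
    ultimately show ?thesis
      using i y pure_in_C by (simp add: idx_prime_def)
  qed
  have "Ytw_gens n q \<subseteq> {y. \<Delta> y \<in> ?C}"
    unfolding Ytw_gens_def using s_mem inv_mem by auto
  then have "Ytw_gens n q \<subseteq> {y \<in> carrier ?U. \<Delta> y \<in> ?C}"
    using Ytw_gens_closed[OF assms(1), of n] by auto
  then have "subalg_gen ?U (Ytw_gens n q) \<subseteq> {y \<in> carrier ?U. \<Delta> y \<in> ?C}"
    by (rule U.subalg_gen_minimal[OF is_subalg_vimage[OF U.complex_alg_axioms P.T.complex_alg_axioms hom C]])
  then have "\<Delta> ` ?Y \<subseteq> ?C"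
    unfolding Ytw_sp_eq[symmetric] by auto
  then show ?thesis
    using coproduct by blast
qed

end
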